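(* For every fixed integer $s\ge 3$, there exists a constant $C_s>0$ such that, for all sufficiently large $n$, \[ f_{s,s+1}^{(3)}(n)\le C_s\frac{\log n}{\log\log n}. \]
   Context: A $k$-graph is a $k$-uniform hypergraph, and $K_t^{(k)}$ denotes the complete $k$-graph on $t$ vertices. A $k$-graph is $K_t^{(k)}$-free if it contains no copy of $K_t^{(k)}$. For integers $k\le s<t$, the Erdős–Rogers function $f_{s,t}^{(k)}(n)$ is the largest integer $m$ such that every $n$-vertex $K_t^{(k)}$-free $k$-graph contains a set of $m$ vertices spanning no copy of $K_s^{(k)}$ (i.e. the induced subhypergraph on this set is $K_s^{(k)}$-free). Equivalently, $f_{s,t}^{(k)}(n)=\min\{\alpha_s(H): |V(H)|=n,\ H \text{ is a } K_t^{(k)}\text{-free } k\text{-graph}\}$, where $\alpha_s(H)$ is the largest size of a set $W\subseteq V(H)$ such that the induced subhypergraph $H[W]$ contains no copy of $K_s^{(k)}$. *)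

theory Defs
  imports Complex_Main
begin

definition kgraph :: "nat \<Rightarrow> 'a set \<Rightarrow> 'a set set \<Rightarrow> bool" where
  "kgraph k V E \<longleftrightarrow> finite V \<and> (\<forall>e\<in>E. e \<subseteq> V \<and> card e = k)"

definition induced_edges :: "'a set set \<Rightarrow> 'a set \<Rightarrow> 'a set set" where
  "induced_edges E W = {e \<in> E. e \<subseteq> W}"

definition contains_complete :: "nat \<Rightarrow> nat \<Rightarrow> 'a set \<Rightarrow> 'a set set \<Rightarrow> bool" where
  "contains_complete k t V E \<longleftrightarrow>
     (\<exists>T\<subseteq>V. card T = t \<and> (\<forall>e\<subseteq>T. card e = k \<longrightarrow> e \<in> E))"

definition has_free_set :: "nat \<Rightarrow> nat \<Rightarrow> nat \<Rightarrow> 'a set \<Rightarrow> 'a set set \<Rightarrow> bool" where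
  "has_free_set k s m V E \<longleftrightarrow>
     (\<exists>W\<subseteq>V. card W = m \<and> \<not> contains_complete k s W (induced_edges E W))"

text \<open>
  A definition cannot quantify over all vertex types, so the hypergraphs range over
  all finite vertex sets of natural numbers; these represent all finite hypergraphs
  up to isomorphism.  The maximum exists whenever \<open>1 \<le> k \<le> s < t\<close>,
  as \<open>le_erdos_rogers_iff\<close> below shows.
\<close>

definition erdos_rogers :: "nat \<Rightarrow> nat \<Rightarrow> nat \<Rightarrow> nat \<Rightarrow> nat" where
  "erdos_rogers k s t n =
     (GREATEST m. \<forall>(V::nat set) E. kgraph k V E \<and> card V = n \<and> \<not> contains_complete k t V E
        \<longrightarrow> has_free_set k s m V E)"

lemma has_free_set_mono:
  assumes "has_free_set k s m V E" "m' \<le> m"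
  shows "has_free_set k s m' V E"
proof -
  obtain W where W: "W \<subseteq> V" "card W = m" "\<not> contains_complete k s W (induced_edges E W)"
    using assms(1) unfolding has_free_set_def by blast
  obtain W' where W': "W' \<subseteq> W" "card W' = m'"
    using obtain_subset_with_card_n[of m' W] W(2) assms(2) by blast
  have "\<not> contains_complete k s W' (induced_edges E W')"
  proof
    assume "contains_complete k s W' (induced_edges E W')"
    then obtain T where T: "T \<subseteq> W'" "card T = s"
        "\<And>e. e \<subseteq> T \<Longrightarrow> card e = k \<Longrightarrow> e \<in> E"
      unfolding contains_complete_def induced_edges_def by auto
    have "T \<subseteq> W"
      using T(1) W'(1) by simp
    moreover from this have "\<forall>e\<subseteq>T. card e = k \<longrightarrow> e \<in> induced_edges E W"
      using T(3) unfolding induced_edges_def by auto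
    ultimately have "contains_complete k s W (induced_edges E W)"
      using T(2) unfolding contains_complete_def by (intro exI[of _ T]) simp
    with W(3) show False ..
  qed
  moreover have "W' \<subseteq> V"
    using W(1) W'(1) by simp
  ultimately show ?thesis
    using W'(2) unfolding has_free_set_def by (intro exI[of _ W']) simp
qed

lemma le_erdos_rogers_iff:
  assumes "1 \<le> k" "k \<le> s" "s < t"
  shows "m \<le> erdos_rogers k s t n \<longleftrightarrow>
    (\<forall>(V::nat set) E. kgraph k V E \<and> card V = n \<and> \<not> contains_complete k t V E
        \<longrightarrow> has_free_set k s m V E)" (is "_ \<longleftrightarrow> ?P m")
proof -
  have bound: "j \<le> n" if "?P j" for j
  proof -
    have "kgraph k {..<n} {}"
      by (simp add: kgraph_def)
    moreover have "\<not> contains_complete k t {..<n} {}"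
    proof
      assume "contains_complete k t {..<n} {}"
      then obtain T :: "nat set" where T: "card T = t" "\<forall>e\<subseteq>T. card e \<noteq> k"
        unfolding contains_complete_def by blast
      have "k \<le> card T"
        using T(1) assms by simp
      then obtain e where "e \<subseteq> T" "card e = k"
        by (rule obtain_subset_with_card_n)
      then show False
        using T(2) by blast
    qed
    ultimately have "has_free_set k s j {..<n} {}"
      using that by simp
    then obtain W where "W \<subseteq> {..<n}" "card W = j"
      unfolding has_free_set_def by blast
    then show ?thesis
      using card_mono[of "{..<n}" W] by simp
  qed
  have "?P 0"
  proof (intro allI impI)
    fix V :: "nat set" and E :: "nat set set"
    have "\<not> contains_complete k s {} (induced_edges E {})"
      using assms by (auto simp: contains_complete_def)
    then show "has_free_set k s 0 V E"
      unfolding has_free_set_def by (intro exI[of _ "{}"]) simp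
  qed
  with bound have "?P (erdos_rogers k s t n)"
    unfolding erdos_rogers_def by (rule GreatestI_nat[where P = ?P and b = n, rotated])
  then have "?P m" if "m \<le> erdos_rogers k s t n"
  proof (intro allI impI)
    fix V :: "nat set" and E :: "nat set set"
    assume H: "kgraph k V E \<and> card V = n \<and> \<not> contains_complete k t V E"
    then have *: "has_free_set k s (erdos_rogers k s t n) V E"
      using \<open>?P (erdos_rogers k s t n)\<close> by simp
    show "has_free_set k s m V E"
      by (rule has_free_set_mono[OF * that])
  qed
  moreover have "m \<le> erdos_rogers k s t n" if "?P m"
    unfolding erdos_rogers_def using that bound by (rule Greatest_le_nat[where P = ?P and b = n])
  ultimately show ?thesis
    by (rule iffI)
qed

end

theory Submission
  imports Defs "HOL-Library.FuncSet"
begin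

text \<open>
Colour the pairs of vertices at random with colours from a set \<open>R\<close>, where \<open>r = |R|\<close> is a small power of
\<open>ln n\<close>, and let \<open>u < v < w\<close> span an edge if \<open>\<chi> u v\<close> and \<open>\<chi> u w\<close> are adjacent in a fixed
graph on \<open>R\<close> without cliques of size \<open>s\<close>.  In a clique on \<open>s + 1\<close> vertices the colours from the
first vertex to the other ones would form a clique of size \<open>s\<close> in the colour graph, so the hypergraph has no
complete subgraph on \<open>s + 1\<close> vertices, whatever the colouring is (\<open>forward_edges_clique_free\<close>).

It remains to show that with positive probability every set \<open>W\<close> of \<open>s * \<mu>\<close> vertices, with \<open>\<mu>\<close> of
order \<open>ln n / ln (ln n)\<close>, contains a complete subgraph on \<open>s\<close> vertices.  There are about
\<open>exp (s * \<mu> * ln n)\<close> sets \<open>W\<close>, and \<open>ln n\<close> is of order \<open>\<mu> * ln r\<close>, so the union bound asks for a failure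
probability of \<open>r powr (- c * \<mu>\<^sup>2)\<close>: a failure must fix a constant proportion of the information in the colours of
all pairs of \<open>W\<close>.  This is where the number of colours has to grow with \<open>n\<close>; a bounded number of colours
can only give failure probability \<open>exp (- c * \<mu>\<^sup>2)\<close> and hence sets of size \<open>ln n\<close>.

The colour graph has the words of length \<open>d\<close> over \<open>s - 1\<close> letters as vertices; two words are adjacent if they agree in few
positions.  By pigeonhole \<open>s\<close> words have many agreements, so there is no clique of size \<open>s\<close>.  By
concentration of measure, any \<open>t \<le> s - 1\<close> sets of at least \<open>r powr (1 - \<epsilon>)\<close> colours contain a transversal
clique (\<open>colour_graph_exists\<close>); this property is called \<open>rich\<close> below.

To find a complete subgraph in \<open>W\<close>, cut \<open>W\<close> into \<open>s\<close> consecutive blocks of size \<open>\<mu>\<close>.  In one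
block after the other, choose a small set of vertices such that almost all tuples taken from the later blocks are
covered: the tuple can be preceded by chosen vertices, one from each earlier block, so that all triples that start
in a chosen vertex are edges.  After the last block the empty tuple is covered, which is a complete subgraph on \<open>s\<close>
vertices (\<open>forward_clique_in_blocks\<close>).  Choose the set in the current block so as to minimise the number
of uncovered tuples plus a penalty for its size.  If many tuples are still uncovered, then about a quarter of the vertices
\<open>v\<close> of the block have colours \<open>\<chi> v\<close> that turn only few members of some dense set of tuples into cliques
(\<open>extend_or_stuck\<close>).  The dense set depends only on the colours at the chosen vertices, so these are about \<open>\<mu> / 4\<close>
independent events, and each of them has probability \<open>r powr (- c * \<mu>)\<close> by the key estimate \<open>few_hits_rare\<close>.
\<close>

section \<open>Counting functions whose values are constrained\<close>

text \<open>
Choose \<open>f\<close> at random.  Once its values off \<open>B\<close> are known, the sets \<open>X v f\<close> are fixed, and the events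
\<open>f v \<in> X v f\<close> for \<open>v \<in> B\<close> are independent with probability at most \<open>\<beta>\<close>.  Both random choices of the proof
use this: the colours from one vertex, where the values are colours, and the whole colouring, where the values are
functions.
\<close>

lemma card_PiE_conditional_le:
  fixes X :: "'a \<Rightarrow> ('a \<Rightarrow> 'b) \<Rightarrow> 'b set" and \<beta> :: real
  assumes A: "finite A" and Om: "finite \<Omega>" and B: "B \<subseteq> A" and \<beta>: "0 \<le> \<beta>"
    and dep: "\<And>v f g. v \<in> B \<Longrightarrow> (\<And>x. x \<in> A - B \<Longrightarrow> f x = g x) \<Longrightarrow> X v f = X v g"
    and bnd: "\<And>v f. v \<in> B \<Longrightarrow> f \<in> PiE A (\<lambda>_. \<Omega>)
                \<Longrightarrow> X v f \<subseteq> \<Omega> \<and> real (card (X v f)) \<le> \<beta> * real (card \<Omega>)"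
  shows "real (card {f \<in> PiE A (\<lambda>_. \<Omega>). \<forall>v\<in>B. f v \<in> X v f})
           \<le> \<beta> ^ card B * real (card \<Omega>) ^ card A"
proof -
  define E where "E = {f \<in> PiE A (\<lambda>_. \<Omega>). \<forall>v\<in>B. f v \<in> X v f}"
  define fib where "fib g = {f \<in> E. restrict f (A - B) = g}" for g
  define I where "I = PiE (A - B) (\<lambda>_. \<Omega>)"
  have finB: "finite B"
    using A B finite_subset by blast
  have finE: "finite E"
    unfolding E_def using A Om by (intro finite_subset[OF _ finite_PiE]) auto
  have finI: "finite I"
    unfolding I_def using A Om by (auto intro: finite_PiE)
  have cardI: "card I = card \<Omega> ^ (card A - card B)"
    unfolding I_def using A B finB by (simp add: card_PiE card_Diff_subset)
  have E_UN: "E \<subseteq> (\<Union>g\<in>I. fib g)"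
    unfolding E_def fib_def I_def by (auto simp: PiE_iff)
  \<comment> \<open>The functions with prescribed values off \<open>B\<close> are determined by an element of a product of sets \<open>X v f0\<close>.\<close>
  have fib_le: "real (card (fib g)) \<le> (\<beta> * real (card \<Omega>)) ^ card B" for g
  proof (cases "fib g = {}")
    case True
    then show ?thesis using \<beta> by simp
  next
    case False
    then obtain f0 where f0: "f0 \<in> fib g" by blast
    have f0E: "f0 \<in> PiE A (\<lambda>_. \<Omega>)"
      using f0 by (auto simp: fib_def E_def)
    have agree: "f x = f0 x" if "f \<in> fib g" "x \<in> A - B" for f x
    proof -
    have "restrict f (A - B) x = restrict f0 (A - B) x" using that f0 by (simp add: fib_def)
    then show ?thesis using that(2) by simp
  qed
    have inj: "inj_on (\<lambda>f. restrict f B) (fib g)"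
    proof (rule inj_onI)
      fix f f' assume f: "f \<in> fib g" "f' \<in> fib g" and eq: "restrict f B = restrict f' B"
      show "f = f'"
      proof
        fix x
        consider "x \<in> B" | "x \<in> A - B" | "x \<notin> A" by blast
        then show "f x = f' x"
        proof cases
          case 1 then show ?thesis using fun_cong[OF eq, of x] by simp
        next
          case 2 then show ?thesis using agree[OF f(1)] agree[OF f(2)] by metis
        next
          case 3 then show ?thesis using f by (auto simp: fib_def E_def PiE_iff extensional_def)
        qed
      qed
    qed
    have "(\<lambda>f. restrict f B) ` fib g \<subseteq> PiE B (\<lambda>v. X v f0)"
    proof (rule image_subsetI)
      fix f assume f: "f \<in> fib g"
      have "f v \<in> X v f0" if "v \<in> B" for v
        using f dep[OF that, of f f0] agree[OF f] that by (auto simp: fib_def E_def)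
      then show "restrict f B \<in> PiE B (\<lambda>v. X v f0)" by auto
    qed
    moreover have "finite (PiE B (\<lambda>v. X v f0))"
      using finB bnd[OF _ f0E] Om by (auto intro!: finite_PiE intro: finite_subset)
    ultimately have "card (fib g) \<le> card (PiE B (\<lambda>v. X v f0))"
      using inj card_inj_on_le by blast
    also have "\<dots> = (\<Prod>v\<in>B. card (X v f0))"
      using finB by (rule card_PiE)
    finally have "real (card (fib g)) \<le> (\<Prod>v\<in>B. real (card (X v f0)))"
      by (simp flip: of_nat_prod)
    also have "\<dots> \<le> (\<Prod>v\<in>B. \<beta> * real (card \<Omega>))"
      using bnd[OF _ f0E] by (intro prod_mono) auto
    finally show ?thesis by simp
  qed
  have "card E \<le> card (\<Union>g\<in>I. fib g)"
    using E_UN finI finE by (intro card_mono) (auto simp: fib_def)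
  also have "\<dots> \<le> (\<Sum>g\<in>I. card (fib g))"
    using finI by (rule card_UN_le)
  finally have "real (card E) \<le> (\<Sum>g\<in>I. real (card (fib g)))"
    by (simp flip: of_nat_sum)
  also have "\<dots> \<le> (\<Sum>g\<in>I. (\<beta> * real (card \<Omega>)) ^ card B)"
    by (intro sum_mono fib_le)
  also have "\<dots> = \<beta> ^ card B * (real (card \<Omega>) ^ card B * real (card \<Omega>) ^ (card A - card B))"
    by (simp add: cardI power_mult_distrib)
  also have "real (card \<Omega>) ^ card B * real (card \<Omega>) ^ (card A - card B) = real (card \<Omega>) ^ card A"
    using card_mono[OF A B] by (simp flip: power_add)
  finally show ?thesis unfolding E_def .
qed

section \<open>Products of blocks\<close>

lemma in_listset_iff: "xs \<in> listset As \<longleftrightarrow> list_all2 (\<in>) xs As"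
  by (induction As arbitrary: xs) (auto simp: set_Cons_def list_all2_Cons2)

lemma in_listset_Cons: "x # xs \<in> listset (A # As) \<longleftrightarrow> x \<in> A \<and> xs \<in> listset As"
  by (auto simp: set_Cons_def)

lemma length_listset: "xs \<in> listset As \<Longrightarrow> length xs = length As"
  by (simp add: in_listset_iff list_all2_lengthD)

lemma set_listset: "xs \<in> listset As \<Longrightarrow> set xs \<subseteq> \<Union> (set As)"
proof (induction As arbitrary: xs)
  case (Cons A As)
  then obtain y ys where "xs = y # ys" "y \<in> A" "ys \<in> listset As" by (auto simp: set_Cons_def)
  then show ?case using Cons.IH[of ys] by auto
qed simp

lemma listset_Cons_eq: "listset (A # As) = (\<lambda>(x, xs). x # xs) ` (A \<times> listset As)"
  by (auto simp: set_Cons_def)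

lemma finite_listset: "(\<And>A. A \<in> set As \<Longrightarrow> finite A) \<Longrightarrow> finite (listset As)"
  by (induction As) (auto simp: listset_Cons_eq simp del: listset.simps(2))

lemma card_listset:
  assumes "\<And>A. A \<in> set As \<Longrightarrow> card A = \<mu>"
  shows "card (listset As) = \<mu> ^ length As"
  using assms
proof (induction As)
  case (Cons A As)
  have "inj_on (\<lambda>(x, xs). x # xs) (A \<times> listset As)" by (auto simp: inj_on_def)
  then show ?case using Cons by (simp add: listset_Cons_eq card_image card_cartesian_product del: listset.simps(2))
qed auto

definition blocks :: "'a set \<Rightarrow> nat \<Rightarrow> 'a set list \<Rightarrow> bool" where
  "blocks A \<mu> Fs \<longleftrightarrow> (\<forall>F\<in>set Fs. F \<subseteq> A \<and> card F = \<mu>) \<and> sorted_wrt (\<lambda>F G. F \<inter> G = {}) Fs"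

lemma blocks_Cons: "blocks A \<mu> (F # Fs) \<longleftrightarrow>
    F \<subseteq> A \<and> card F = \<mu> \<and> (\<forall>G\<in>set Fs. F \<inter> G = {}) \<and> blocks A \<mu> Fs"
  by (auto simp: blocks_def)

lemma blocks_finite_listset: "finite A \<Longrightarrow> blocks A \<mu> Fs \<Longrightarrow> finite (listset Fs)"
  by (rule finite_listset) (auto simp: blocks_def intro: finite_subset)

lemma blocks_card_listset: "blocks A \<mu> Fs \<Longrightarrow> card (listset Fs) = \<mu> ^ length Fs"
  by (rule card_listset) (auto simp: blocks_def)

text \<open>
Tuples are lists, so that the first coordinate can be split off in the inductions on the number of blocks and on the length of words.
\<close>

definition slice :: "'a list set \<Rightarrow> 'a \<Rightarrow> 'a list set" where
  "slice D x = {xs. x # xs \<in> D}"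

lemma card_eq_sum_slices:
  assumes "finite F" "finite D" "D \<subseteq> listset (F # Fs)"
  shows "card D = (\<Sum>x\<in>F. card (slice D x))"
proof -
  have D: "D = (\<Union>x\<in>F. (#) x ` slice D x)"
  proof -
    have "xs \<in> (\<Union>x\<in>F. (#) x ` slice D x)" if "xs \<in> D" for xs
    proof -
      obtain y ys where "xs = y # ys" "y \<in> F" using assms(3) \<open>xs \<in> D\<close> by (auto simp: set_Cons_def)
      then show ?thesis using \<open>xs \<in> D\<close> by (auto simp: slice_def)
    qed
    moreover have "(\<Union>x\<in>F. (#) x ` slice D x) \<subseteq> D" by (auto simp: slice_def)
    ultimately show ?thesis by blast
  qed
  have fin: "finite (slice D x)" for x
  proof -
    have "(#) x ` slice D x \<subseteq> D" by (auto simp: slice_def)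
    then show ?thesis using assms(2) by (meson finite_imageD finite_subset inj_on_Cons1)
  qed
  have "card D = (\<Sum>x\<in>F. card ((#) x ` slice D x))"
    by (subst D, rule card_UN_disjoint) (use assms(1) fin in auto)
  also have "\<dots> = (\<Sum>x\<in>F. card (slice D x))"
    by (intro sum.cong refl card_image) simp
  finally show ?thesis .
qed

section \<open>Rich relations and colourings with few hits\<close>

text \<open>
The pseudorandomness required of the colour graph, for an arbitrary relation \<open>T\<close> in place of its cliques, because
the induction in \<open>few_hits_rare\<close> replaces \<open>T\<close> by projections of it.
\<close>

definition rich :: "real \<Rightarrow> 'c set \<Rightarrow> nat \<Rightarrow> 'c list set \<Rightarrow> bool" where
  "rich \<rho> R t T \<longleftrightarrow>
     (\<forall>Ss. length Ss = t \<longrightarrow> (\<forall>S\<in>set Ss. S \<subseteq> R \<and> \<rho> \<le> real (card S)) \<longrightarrow> listset Ss \<inter> T \<noteq> {})"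

lemma rich_project:
  assumes "rich \<rho> R (Suc t) T" "L \<subseteq> R" "\<rho> \<le> real (card L)"
  shows "rich \<rho> R t {as. \<exists>a\<in>L. a # as \<in> T}"
  unfolding rich_def
proof (intro allI impI)
  fix Ss assume Ss: "length Ss = t" "\<forall>S\<in>set Ss. S \<subseteq> R \<and> \<rho> \<le> real (card S)"
  have "listset (L # Ss) \<inter> T \<noteq> {}"
    using assms Ss unfolding rich_def by (metis length_Cons set_ConsD)
  then show "listset Ss \<inter> {as. \<exists>a\<in>L. a # as \<in> T} \<noteq> {}"
    by (auto simp: set_Cons_def)
qed

definition hits :: "'c list set \<Rightarrow> 'a list set \<Rightarrow> ('a \<Rightarrow> 'c) \<Rightarrow> 'a list set" where
  "hits T D \<phi> = {xs \<in> D. map \<phi> xs \<in> T}"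

lemma hits_cong:
  assumes "\<And>x. x \<in> \<Union> (set ` D) \<Longrightarrow> \<phi> x = \<psi> x"
  shows "hits T D \<phi> = hits T D \<psi>"
proof -
  have "map \<phi> xs = map \<psi> xs" if "xs \<in> D" for xs
    using that assms by auto
  then have "xs \<in> D \<and> map \<phi> xs \<in> T \<longleftrightarrow> xs \<in> D \<and> map \<psi> xs \<in> T" for xs
    by (metis (no_types))
  then show ?thesis unfolding hits_def by (rule Collect_cong)
qed

text \<open>
A dense set \<open>D\<close> of tuples is hit by the rich relation \<open>T\<close> many times, except for an exponentially small
proportion of the maps \<open>\<phi>\<close>; when \<open>r / \<rho>\<close> is a power of \<open>r\<close> and \<open>b\<close> is proportional to \<open>\<mu>\<close>, the
exponent is a constant proportion of the information that \<open>\<phi>\<close> carries on the blocks.  Induct on the number of blocks.  For a point \<open>x\<close> of the first block whose slice of \<open>D\<close> is dense,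
let \<open>L x\<close> be the set of colours which, given to \<open>x\<close>, lead to few hits in this slice.  If some \<open>L x\<close>
has at least \<open>\<rho>\<close> elements, then \<open>\<phi>\<close> has few hits in the slice also for the relation obtained from
\<open>T\<close> by projecting along \<open>L x\<close>.  This relation is rich, so the case is rare by induction.  If all
\<open>L x\<close> are small, then few hits in \<open>D\<close> mean that \<open>\<phi> x \<in> L x\<close> for at least \<open>b\<close> points \<open>x\<close>, and
\<open>L x\<close> does not depend on the values of \<open>\<phi>\<close> on the first block.
\<close>

lemma few_hits_rare:
  fixes A :: "'a set" and R :: "'c set" and \<kappa> \<rho> :: real
  assumes A: "finite A" and R: "finite R" "R \<noteq> {}" and \<kappa>: "0 < \<kappa>"
    and \<mu>: "real b \<le> \<kappa> * real \<mu>" "0 < \<mu>" and \<rho>: "0 \<le> \<rho>"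
  shows "rich \<rho> R t T \<Longrightarrow> length Fs = t \<Longrightarrow> blocks A \<mu> Fs \<Longrightarrow> D \<subseteq> listset Fs \<Longrightarrow>
      4 * \<kappa> * 2 ^ t * real \<mu> ^ t \<le> real (card D) \<Longrightarrow>
      real (card {\<phi> \<in> PiE A (\<lambda>_. R).
          real (card (hits T D \<phi>)) \<le> (\<kappa> / real (card R)) ^ t / 2 * real \<mu> ^ t})
      \<le> real t * (real \<mu> * 2 ^ card R) ^ t * (2 ^ \<mu> * (\<rho> / real (card R)) ^ b)
          * real (card R) ^ card A"
proof (induction t arbitrary: T Fs D)
  case 0
  have "D \<noteq> {}" using 0(5) \<kappa> by auto
  then have D: "D = {[]}" using 0 by auto
  have "[] \<in> T" using 0(1) by (auto simp: rich_def)
  then have "hits T D \<phi> = {[]}" for \<phi> :: "'a \<Rightarrow> 'c" by (auto simp: hits_def D)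
  then show ?case by simp
next
  case (Suc t)
  obtain F Fs' where Fs: "Fs = F # Fs'" and len: "length Fs' = t"
    using Suc.prems(2) by (cases Fs) auto
  define r where "r = real (card R)"
  define M where "M = real \<mu> ^ t"
  define \<theta> where "\<theta> = (\<kappa> / r) ^ t / 2 / r"
  define \<beta> where "\<beta> = 2 ^ \<mu> * (\<rho> / r) ^ b"
  define X where "X = {x \<in> F. 4 * \<kappa> * 2 ^ t * M \<le> real (card (slice D x))}"
  define L where "L \<phi> x = {a \<in> R. real (card (hits (slice T a) (slice D x) \<phi>)) \<le> \<theta> * M}" for \<phi> x
  define \<Omega> where "\<Omega> = PiE A (\<lambda>_. R)"
  define Bad where "Bad = {\<phi> \<in> \<Omega>. real (card (hits T D \<phi>)) \<le> (\<kappa> / r) ^ Suc t / 2 * real \<mu> ^ Suc t}"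
  define Bad1 where "Bad1 x Ls = {\<phi> \<in> \<Omega>. real (card (hits {as. \<exists>a\<in>Ls. a # as \<in> T} (slice D x) \<phi>))
     \<le> (\<kappa> / r) ^ t / 2 * M}" for x Ls
  define Bad2 where "Bad2 Y = {\<phi> \<in> \<Omega>. \<forall>x\<in>Y. \<phi> x \<in> (if real (card (L \<phi> x)) \<le> \<rho> then L \<phi> x else {})}" for Y
  have r: "0 < r" using R by (simp add: r_def card_gt_0_iff)
  have M: "0 < M" using \<mu> by (simp add: M_def)
  have \<theta>: "0 < \<theta>" using r \<kappa> by (simp add: \<theta>_def)
  have \<beta>: "0 \<le> \<beta>" using r \<rho> by (simp add: \<beta>_def)
  have bl: "F \<subseteq> A" "card F = \<mu>" "\<And>G. G \<in> set Fs' \<Longrightarrow> F \<inter> G = {}" "blocks A \<mu> Fs'"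
    using Suc.prems(3) by (auto simp: Fs blocks_Cons)
  have finF: "finite F" using A bl(1) finite_subset by blast
  have finD: "finite D"
    using Suc.prems(3,4) A blocks_finite_listset finite_subset by metis
  have slice_sub: "slice D x \<subseteq> listset Fs'" for x
    using Suc.prems(4) by (auto simp: slice_def Fs set_Cons_def)
  have finlist: "finite (listset Fs')" by (rule blocks_finite_listset[OF A bl(4)])
  have finslice: "finite (slice D x)" for x
    using slice_sub finlist finite_subset by blast
  have slice_card: "real (card (slice D x)) \<le> M" for x
    using card_mono[OF finlist slice_sub] blocks_card_listset[OF bl(4)] len
    by (simp add: M_def flip: of_nat_power)
  have finhits: "finite (hits T' (slice D x) \<phi>)" for T' x and \<phi> :: "'a \<Rightarrow> 'c"
    using finslice by (auto simp: hits_def)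
  have fin\<Omega>: "finite \<Omega>" unfolding \<Omega>_def using A R by (intro finite_PiE) auto
  have finX: "finite X" using finF by (simp add: X_def)
  \<comment> \<open>At most half of \<open>D\<close> lies in slices that are not dense; hence the factor \<open>2 ^ t\<close>.\<close>
  have X_large: "4 * \<kappa> * real \<mu> \<le> real (card X)"
  proof -
    have "4 * \<kappa> * 2 ^ Suc t * real \<mu> ^ Suc t \<le> (\<Sum>x\<in>F. real (card (slice D x)))"
      using Suc.prems(5) card_eq_sum_slices[OF finF finD Suc.prems(4)[unfolded Fs]]
      by (simp flip: of_nat_sum)
    also have "\<dots> = (\<Sum>x\<in>X. real (card (slice D x))) + (\<Sum>x\<in>F - X. real (card (slice D x)))"
      using finF by (subst sum.subset_diff[of X F]) (auto simp: X_def)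
    also have "\<dots> \<le> (\<Sum>x\<in>X. M) + (\<Sum>x\<in>F - X. 4 * \<kappa> * 2 ^ t * M)"
      using slice_card by (intro add_mono sum_mono) (auto simp: X_def)
    also have "\<dots> \<le> real (card X) * M + real \<mu> * (4 * \<kappa> * 2 ^ t * M)"
    proof -
      have "card (F - X) \<le> \<mu>" using bl(2) finF by (metis card_mono Diff_subset)
      then show ?thesis using \<kappa> M by (auto intro!: mult_right_mono)
    qed
    finally have "(4 * \<kappa> * 2 ^ t * real \<mu>) * M \<le> real (card X) * M"
      by (simp add: M_def algebra_simps)
    then have "4 * \<kappa> * 2 ^ t * real \<mu> \<le> real (card X)" using M by simp
    moreover have "4 * \<kappa> * real \<mu> * 1 \<le> 4 * \<kappa> * real \<mu> * 2 ^ t"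
      using \<kappa> by (intro mult_left_mono) auto
    ultimately show ?thesis by (simp add: algebra_simps)
  qed
  \<comment> \<open>The union over \<open>Ls\<close> costs only \<open>2 ^ card R\<close>, since \<open>R\<close> is small compared with \<open>\<mu>\<close>.\<close>
  have cover: "Bad \<subseteq> (\<Union>(x, Ls)\<in>X \<times> {Ls \<in> Pow R. \<rho> \<le> real (card Ls)}. Bad1 x Ls) \<union> (\<Union>Y\<in>{Y \<in> Pow F. card Y = b}. Bad2 Y)"
  proof
    fix \<phi> assume \<phi>: "\<phi> \<in> Bad"
    have LR: "L \<phi> x \<subseteq> R" for x by (auto simp: L_def)
    have finL: "finite (L \<phi> x)" for x using LR R(1) finite_subset by blast
    show "\<phi> \<in> (\<Union>(x, Ls)\<in>X \<times> {Ls \<in> Pow R. \<rho> \<le> real (card Ls)}. Bad1 x Ls) \<union> (\<Union>Y\<in>{Y \<in> Pow F. card Y = b}. Bad2 Y)"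
    proof (cases "\<exists>x\<in>X. \<rho> \<le> real (card (L \<phi> x))")
      case True
      then obtain x where x: "x \<in> X" "\<rho> \<le> real (card (L \<phi> x))" by blast
      have "hits {as. \<exists>a\<in>L \<phi> x. a # as \<in> T} (slice D x) \<phi> \<subseteq> (\<Union>a\<in>L \<phi> x. hits (slice T a) (slice D x) \<phi>)"
        by (auto simp: hits_def slice_def)
      then have "card (hits {as. \<exists>a\<in>L \<phi> x. a # as \<in> T} (slice D x) \<phi>)
          \<le> card (\<Union>a\<in>L \<phi> x. hits (slice T a) (slice D x) \<phi>)"
        using finhits finL by (intro card_mono) auto
      also have "\<dots> \<le> (\<Sum>a\<in>L \<phi> x. card (hits (slice T a) (slice D x) \<phi>))"
        using finL by (rule card_UN_le)
      finally have "real (card (hits {as. \<exists>a\<in>L \<phi> x. a # as \<in> T} (slice D x) \<phi>))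
          \<le> (\<Sum>a\<in>L \<phi> x. real (card (hits (slice T a) (slice D x) \<phi>)))"
        by (simp flip: of_nat_sum)
      also have "\<dots> \<le> (\<Sum>a\<in>L \<phi> x. \<theta> * M)"
        by (intro sum_mono) (auto simp: L_def)
      also have "\<dots> \<le> r * (\<theta> * M)"
        using card_mono[OF R(1) LR, of x] \<theta> M by (auto simp: r_def intro!: mult_right_mono)
      also have "\<dots> = (\<kappa> / r) ^ t / 2 * M" using r by (simp add: \<theta>_def)
      finally have "\<phi> \<in> Bad1 x (L \<phi> x)" using \<phi> by (auto simp: Bad1_def Bad_def)
      then show ?thesis using x LR by blast
    next
      case False
      define Y where "Y = {x \<in> X. \<phi> x \<in> L \<phi> x}"
      have finY: "finite Y" using finX by (simp add: Y_def)
      have hit_slice: "slice (hits T D \<phi>) x = hits (slice T (\<phi> x)) (slice D x) \<phi>" for x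
        by (auto simp: slice_def hits_def)
      have \<phi>R: "\<phi> x \<in> R" if "x \<in> F" for x
        using that \<phi> bl(1) by (auto simp: Bad_def \<Omega>_def)
      have "real (card (X - Y)) * (\<theta> * M) = (\<Sum>x\<in>X - Y. \<theta> * M)" by simp
      also have "\<dots> \<le> (\<Sum>x\<in>X - Y. real (card (slice (hits T D \<phi>) x)))"
        using \<phi>R unfolding hit_slice
        by (intro sum_mono) (auto simp: Y_def L_def X_def)
      also have "\<dots> \<le> (\<Sum>x\<in>F. real (card (slice (hits T D \<phi>) x)))"
        using finF by (intro sum_mono2) (auto simp: X_def)
      also have "\<dots> = real (card (hits T D \<phi>))"
      proof -
        have "hits T D \<phi> \<subseteq> D" by (auto simp: hits_def)
        then have "card (hits T D \<phi>) = (\<Sum>x\<in>F. card (slice (hits T D \<phi>) x))"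
          using finD Suc.prems(4) by (intro card_eq_sum_slices[OF finF]) (auto simp: Fs intro: finite_subset)
        then show ?thesis by simp
      qed
      also have "\<dots> \<le> (\<kappa> / r) ^ Suc t / 2 * real \<mu> ^ Suc t" using \<phi> by (simp add: Bad_def)
      also have "\<dots> = (\<kappa> * real \<mu>) * (\<theta> * M)" by (simp add: \<theta>_def M_def mult_ac)
      finally have "real (card (X - Y)) \<le> \<kappa> * real \<mu>" using \<theta> M by simp
      moreover have "card (X - Y) = card X - card Y" "card Y \<le> card X"
        using finX finY by (auto simp: card_Diff_subset Y_def intro: card_mono)
      ultimately have "real (card Y) \<ge> 3 * (\<kappa> * real \<mu>)"
        using X_large by (simp add: of_nat_diff)
      then have "b \<le> card Y" using \<mu>(1) \<kappa> by simp
      then obtain Y' where Y': "Y' \<subseteq> Y" "card Y' = b" by (meson obtain_subset_with_card_n)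
      have "\<phi> \<in> Bad2 Y'"
        using \<phi> Y' False by (fastforce simp: Bad2_def Bad_def Y_def)
      then show ?thesis using Y' by (auto simp: Y_def X_def)
    qed
  qed
  have part1: "real (card (Bad1 x Ls)) \<le> real t * (real \<mu> * 2 ^ card R) ^ t * \<beta> * r ^ card A"
    if "x \<in> X" "Ls \<subseteq> R" "\<rho> \<le> real (card Ls)" for x Ls
    using Suc.IH[OF rich_project[OF Suc.prems(1) that(2,3)] len bl(4) slice_sub[of x]] that(1)
    by (simp add: Bad1_def r_def M_def X_def \<beta>_def \<Omega>_def)
  have part2: "real (card (Bad2 Y)) \<le> (\<rho> / r) ^ b * r ^ card A"
    if "Y \<subseteq> F" "card Y = b" for Y
  proof -
    have "real (card {f \<in> PiE A (\<lambda>_. R). \<forall>x\<in>Y. f x \<in> (if real (card (L f x)) \<le> \<rho> then L f x else {})})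
      \<le> (\<rho> / r) ^ card Y * real (card R) ^ card A"
    proof (rule card_PiE_conditional_le[where X = "\<lambda>x f. if real (card (L f x)) \<le> \<rho> then L f x else {}"])
      show "0 \<le> \<rho> / r" using \<rho> r by simp
      show "Y \<subseteq> A" using that bl(1) by blast
      fix x f assume "x \<in> Y"
      have "L f x \<subseteq> R" by (auto simp: L_def)
      then show "(if real (card (L f x)) \<le> \<rho> then L f x else {}) \<subseteq> R
          \<and> real (card (if real (card (L f x)) \<le> \<rho> then L f x else {})) \<le> \<rho> / r * real (card R)"
        using \<rho> r by (auto simp: r_def)
    next
      fix x f and g :: "'a \<Rightarrow> 'c" assume "x \<in> Y" and eq: "\<And>x. x \<in> A - Y \<Longrightarrow> f x = g x"
      have "f y = g y" if "y \<in> \<Union> (set ` slice D x)" for y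
      proof (rule eq)
        have "y \<in> \<Union> (set Fs')" using that slice_sub[of x] set_listset by blast
        then obtain G where "G \<in> set Fs'" "y \<in> G" by blast
        then show "y \<in> A - Y" using bl(3)[of G] bl(4) \<open>Y \<subseteq> F\<close> by (auto simp: blocks_def)
      qed
      then have "hits T' (slice D x) f = hits T' (slice D x) g" for T' by (rule hits_cong)
      then have "L f x = L g x" by (simp add: L_def)
      then show "(if real (card (L f x)) \<le> \<rho> then L f x else {}) = (if real (card (L g x)) \<le> \<rho> then L g x else {})"
        by simp
    qed (use A R in auto)
    then show ?thesis using that by (simp add: Bad2_def \<Omega>_def r_def)
  qed
  define c where "c = real \<mu> * 2 ^ card R"
  have c: "1 \<le> c" using \<mu>(2) mult_mono[of 1 "real \<mu>" 1 "2 ^ card R"] by (simp add: c_def)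
  have finBad: "finite (Bad1 x Ls)" "finite (Bad2 Y)" for x Ls Y
    using fin\<Omega> by (auto simp: Bad1_def Bad2_def)
  define I where "I = X \<times> {Ls \<in> Pow R. \<rho> \<le> real (card Ls)}"
  define J where "J = {Y \<in> Pow F. card Y = b}"
  have finI: "finite I" "finite J" using finX finF R by (auto simp: I_def J_def)
  have cardI: "real (card I) \<le> c"
  proof -
    have "card I \<le> card X * card (Pow R)"
      unfolding I_def card_cartesian_product using R by (intro mult_left_mono card_mono) auto
    also have "\<dots> \<le> \<mu> * 2 ^ card R"
      using card_mono[of F X] finF bl(2) R(1) by (auto simp: card_Pow X_def)
    finally have "real (card I) \<le> real (\<mu> * 2 ^ card R)" by (rule of_nat_mono)
    then show ?thesis by (simp add: c_def)
  qed
  have cardJ: "real (card J) \<le> 2 ^ \<mu>"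
  proof -
    have "card J \<le> card (Pow F)" unfolding J_def using finF by (intro card_mono) auto
    then have "real (card J) \<le> real (2 ^ \<mu>)" using finF bl(2) by (simp add: card_Pow)
    then show ?thesis by simp
  qed
  have "card Bad \<le> card ((\<Union>(x, Ls)\<in>I. Bad1 x Ls) \<union> (\<Union>Y\<in>J. Bad2 Y))"
    using cover finI finBad unfolding I_def[symmetric] J_def[symmetric]
    by (intro card_mono finite_UnI finite_UN_I) (auto split: prod.splits)
  also have "\<dots> \<le> card (\<Union>(x, Ls)\<in>I. Bad1 x Ls) + card (\<Union>Y\<in>J. Bad2 Y)"
    by (rule card_Un_le)
  also have "\<dots> \<le> (\<Sum>(x, Ls)\<in>I. card (Bad1 x Ls)) + (\<Sum>Y\<in>J. card (Bad2 Y))"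
    using card_UN_le[OF finI(1), of "\<lambda>(x, Ls). Bad1 x Ls"] card_UN_le[OF finI(2), of Bad2]
    by (simp add: case_prod_beta)
  finally have "real (card Bad) \<le> (\<Sum>(x, Ls)\<in>I. real (card (Bad1 x Ls))) + (\<Sum>Y\<in>J. real (card (Bad2 Y)))"
    by (simp add: case_prod_beta flip: of_nat_sum of_nat_add)
  also have "\<dots> \<le> (\<Sum>(x, Ls)\<in>I. real t * c ^ t * \<beta> * r ^ card A) + (\<Sum>Y\<in>J. (\<rho> / r) ^ b * r ^ card A)"
    using part1 part2 by (intro add_mono sum_mono) (auto simp: I_def J_def c_def)
  also have "\<dots> \<le> c * (real t * c ^ t * \<beta> * r ^ card A) + 2 ^ \<mu> * ((\<rho> / r) ^ b * r ^ card A)"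
    using cardI cardJ c \<beta> \<rho> r by (auto simp: case_prod_beta intro!: add_mono mult_right_mono)
  also have "\<dots> = (real t * c ^ Suc t + 1) * (\<beta> * r ^ card A)"
    by (simp add: \<beta>_def algebra_simps)
  also have "\<dots> \<le> (real t * c ^ Suc t + c ^ Suc t) * (\<beta> * r ^ card A)"
    using one_le_power[OF c, of "Suc t"] \<beta> r by (intro mult_right_mono add_mono) auto
  also have "\<dots> = real (Suc t) * c ^ Suc t * \<beta> * r ^ card A" by (simp add: algebra_simps)
  finally show ?case
    by (simp add: Bad_def \<Omega>_def c_def \<beta>_def r_def)
qed

section \<open>The colour graph\<close>

definition words :: "nat \<Rightarrow> nat \<Rightarrow> nat list set" where
  "words q d = listset (replicate d {..<q})"

definition hamming :: "nat \<Rightarrow> nat list \<Rightarrow> nat list \<Rightarrow> nat" where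
  "hamming d x y = card {i. i < d \<and> x ! i \<noteq> y ! i}"

definition agree :: "nat \<Rightarrow> nat list \<Rightarrow> nat list \<Rightarrow> nat" where
  "agree d x y = card {i. i < d \<and> x ! i = y ! i}"

lemma words_Suc: "words q (Suc d) = (\<lambda>(a, x). a # x) ` ({..<q} \<times> words q d)"
  unfolding words_def replicate_Suc by (rule listset_Cons_eq)

lemma finite_words: "finite (words q d)"
  unfolding words_def by (rule finite_listset) simp

lemma card_words: "card (words q d) = q ^ d"
  unfolding words_def by (subst card_listset[of _ q]) auto

lemma in_words_iff: "x \<in> words q d \<longleftrightarrow> length x = d \<and> (\<forall>i<d. x ! i < q)"
  by (auto simp: words_def in_listset_iff list_all2_conv_all_nth)

lemma hamming_Cons: "hamming (Suc d) (a # x) (b # y) = (if a = b then 0 else 1) + hamming d x y"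
proof -
  have "{i. i < Suc d \<and> (a # x) ! i \<noteq> (b # y) ! i}
      = (if a = b then {} else {0}) \<union> Suc ` {i. i < d \<and> x ! i \<noteq> y ! i}"
    by (auto simp: less_Suc_eq_0_disj)
  moreover have "card (Suc ` {i. i < d \<and> x ! i \<noteq> y ! i}) = hamming d x y"
    by (simp add: hamming_def card_image)
  moreover have "card ((if a = b then {} else {0}) \<union> Suc ` {i. i < d \<and> x ! i \<noteq> y ! i})
      = card (if a = b then {} else {0::nat}) + card (Suc ` {i. i < d \<and> x ! i \<noteq> y ! i})"
    by (rule card_Un_disjoint) auto
  ultimately show ?thesis
    unfolding hamming_def[of "Suc d"] by simp
qed

lemma agree_triangle: "agree d a b \<le> hamming d a' a + hamming d b' b + agree d a' b'"
proof -
  have "card {i. i < d \<and> a ! i = b ! i} \<le> card (({i. i < d \<and> a' ! i \<noteq> a ! i} \<union> {i. i < d \<and> b' ! i \<noteq> b ! i})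
      \<union> {i. i < d \<and> a' ! i = b' ! i})"
    by (intro card_mono) auto
  also have "\<dots> \<le> card ({i. i < d \<and> a' ! i \<noteq> a ! i} \<union> {i. i < d \<and> b' ! i \<noteq> b ! i})
      + card {i. i < d \<and> a' ! i = b' ! i}"
    by (rule card_Un_le)
  also have "\<dots> \<le> (card {i. i < d \<and> a' ! i \<noteq> a ! i} + card {i. i < d \<and> b' ! i \<noteq> b ! i})
      + card {i. i < d \<and> a' ! i = b' ! i}"
    by (intro add_mono card_Un_le) simp
  finally show ?thesis by (simp add: agree_def hamming_def)
qed

text \<open>
Both sides agree at \<open>p = 1\<close> and \<open>p = 1 / E\<close>, and \<open>1 / p\<close> is convex.
\<close>

lemma chord_bound:
  fixes E p :: real
  assumes "1 < E" "1 \<le> E * p" "p \<le> 1"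
  shows "1 / p \<le> 1 + E - E * p"
proof -
  have p: "0 < p" using assms by (smt (verit) mult_nonneg_nonpos)
  have "(E * p - 1) * (p - 1) \<le> 0"
    using assms by (intro mult_nonneg_nonpos) auto
  then have "1 \<le> (1 + E - E * p) * p" by (simp add: algebra_simps)
  then show ?thesis using p by (simp add: pos_divide_le_eq)
qed

text \<open>
Concentration of measure: the distance to \<open>S\<close> has a small exponential moment in terms of the density of
\<open>S\<close>.  For the induction, a word \<open>a # x\<close> can approach \<open>S\<close> through the slice of its own first letter \<open>a\<close>, or through the largest
slice, that of \<open>b\<close>, at the cost of one extra mismatch.  The better choice contributes a factor of at most
\<open>min (1 / p) E\<close>, where \<open>p\<close> is the ratio of the two slice sizes, and this minimum lies below the chord
\<open>1 + E - E * p\<close>.  The function \<open>f\<close> is an upper bound for the distance, which avoids minima over empty slices.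
\<close>

lemma exponential_distance_bound:
  fixes E :: real
  assumes E: "1 < E" and q: "0 < q"
  shows "S \<subseteq> words q d \<Longrightarrow> S \<noteq> {} \<Longrightarrow>
    \<exists>f. (\<forall>x\<in>words q d. \<exists>y\<in>S. hamming d x y \<le> f x) \<and>
      real (card S) * (\<Sum>x\<in>words q d. E ^ f x) \<le> ((1 + E)\<^sup>2 / (4 * E)) ^ d * (real q ^ d)\<^sup>2"
proof (induction d arbitrary: S)
  case 0
  then have S: "S = {[]}" "words q 0 = {[]}" by (auto simp: words_def)
  show ?case unfolding S by (intro exI[of _ "\<lambda>_. 0"]) (simp add: hamming_def)
next
  case (Suc d)
  define K where "K = (1 + E)\<^sup>2 / (4 * E)"
  define N where "N = K ^ d * (real q ^ d)\<^sup>2"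
  define n where "n a = card (slice S a)" for a
  have N: "0 \<le> N" using E by (simp add: N_def K_def)
  have finS: "finite S" using Suc.prems finite_words finite_subset by blast
  have sub: "slice S a \<subseteq> words q d" for a
    using Suc.prems(1) by (auto simp: slice_def words_Suc)
  have finsl: "finite (slice S a)" for a using sub finite_words finite_subset by blast
  have cardS: "card S = (\<Sum>a<q. n a)"
    unfolding n_def using Suc.prems(1) finS
    by (intro card_eq_sum_slices[where Fs = "replicate d {..<q}"]) (auto simp: words_def)
  obtain b where b: "b < q" "\<And>a. a < q \<Longrightarrow> n a \<le> n b"
  proof -
    have "Max (n ` {..<q}) \<in> n ` {..<q}" using q by (intro Max_in) auto
    then obtain b where "b < q" "n b = Max (n ` {..<q})" by auto
    then show ?thesis using that[of b] by simp
  qed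
  have nb: "0 < n b"
  proof (rule ccontr)
    assume "\<not> 0 < n b"
    then have "card S = 0" using b(2) cardS by simp
    then show False using finS Suc.prems(2) by simp
  qed
  have "\<exists>g. (\<forall>x\<in>words q d. \<exists>y\<in>slice S a. hamming d x y \<le> g x) \<and>
      real (n a) * (\<Sum>x\<in>words q d. E ^ g x) \<le> N" if "0 < n a" for a
  proof -
    have "slice S a \<noteq> {}" using that by (auto simp: n_def)
    from Suc.IH[OF sub this] show ?thesis by (simp add: n_def N_def K_def)
  qed
  then have "\<forall>a. \<exists>g. 0 < n a \<longrightarrow> (\<forall>x\<in>words q d. \<exists>y\<in>slice S a. hamming d x y \<le> g x) \<and>
      real (n a) * (\<Sum>x\<in>words q d. E ^ g x) \<le> N"
    by blast
  from choice[OF this] obtain g where "\<forall>a. 0 < n a \<longrightarrow>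
      (\<forall>x\<in>words q d. \<exists>y\<in>slice S a. hamming d x y \<le> g a x) \<and>
      real (n a) * (\<Sum>x\<in>words q d. E ^ g a x) \<le> N" ..
  then have g: "\<And>a x. 0 < n a \<Longrightarrow> x \<in> words q d \<Longrightarrow> \<exists>y\<in>slice S a. hamming d x y \<le> g a x"
      "\<And>a. 0 < n a \<Longrightarrow> real (n a) * (\<Sum>x\<in>words q d. E ^ g a x) \<le> N"
    by blast+
  define near where "near a \<longleftrightarrow> real (n b) \<le> E * real (n a)" for a
  have near: "0 < n a" if "near a" for a
    using that nb by (auto simp: near_def intro: Nat.gr0I)
  define h where "h a x = (if near a then g a x else 1 + g b x)" for a x
  define f where "f z = h (hd z) (tl z)" for z
  have dist: "\<exists>y\<in>S. hamming (Suc d) z y \<le> f z" if "z \<in> words q (Suc d)" for z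
  proof -
    obtain a x where z: "z = a # x" "x \<in> words q d"
      using \<open>z \<in> words q (Suc d)\<close> by (auto simp: words_Suc)
    show ?thesis
    proof (cases "near a")
      case True
      then obtain y where "y \<in> slice S a" "hamming d x y \<le> g a x" using g(1) near z(2) by blast
      then show ?thesis using True z by (intro bexI[of _ "a # y"]) (auto simp: f_def h_def slice_def hamming_Cons)
    next
      case False
      obtain y where "y \<in> slice S b" "hamming d x y \<le> g b x" using g(1)[OF nb] z(2) by blast
      then show ?thesis using False z by (intro bexI[of _ "b # y"]) (auto simp: f_def h_def slice_def hamming_Cons)
    qed
  qed
  define p where "p a = real (n a) / real (n b)" for a
  have row: "real (n b) * (\<Sum>x\<in>words q d. E ^ h a x) \<le> N * (1 + E - E * p a)" if "a < q" for a
  proof (cases "near a")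
    case True
    have "real (n b) * (\<Sum>x\<in>words q d. E ^ h a x) = (1 / p a) * (real (n a) * (\<Sum>x\<in>words q d. E ^ g a x))"
      using near[OF True] True by (simp add: h_def p_def)
    also have "\<dots> \<le> (1 / p a) * N"
      using g(2)[OF near[OF True]] by (intro mult_left_mono) (auto simp: p_def)
    also have "\<dots> \<le> (1 + E - E * p a) * N"
      using True b(2)[OF that] nb N E
      by (intro mult_right_mono chord_bound) (auto simp: p_def near_def)
    finally show ?thesis by (simp add: mult.commute)
  next
    case False
    have "real (n b) * (\<Sum>x\<in>words q d. E ^ h a x) = E * (real (n b) * (\<Sum>x\<in>words q d. E ^ g b x))"
      using False by (simp add: h_def sum_distrib_left mult_ac)
    also have "\<dots> \<le> E * N"
      using g(2)[OF nb] E by (intro mult_left_mono) auto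
    also have "\<dots> \<le> (1 + E - E * p a) * N"
    proof (intro mult_right_mono N)
      have "E * p a \<le> 1" using False nb by (simp add: near_def p_def)
      then show "E \<le> 1 + E - E * p a" by simp
    qed
    finally show ?thesis by (simp add: mult.commute)
  qed
  define u where "u = (\<Sum>a<q. p a)"
  have cS: "real (card S) = real (n b) * u"
    using nb by (simp add: cardS u_def p_def sum_distrib_left)
  have u: "0 \<le> u" by (simp add: u_def p_def sum_nonneg)
  have "(\<Sum>z\<in>words q (Suc d). E ^ f z) = (\<Sum>(a, x)\<in>{..<q} \<times> words q d. E ^ h a x)"
    unfolding words_Suc
    by (rule sum.reindex_cong[where l = "\<lambda>(a, x). a # x"]) (auto simp: inj_on_def f_def)
  also have "\<dots> = (\<Sum>a<q. \<Sum>x\<in>words q d. E ^ h a x)"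
    by (rule sum.cartesian_product[symmetric])
  finally have "real (card S) * (\<Sum>z\<in>words q (Suc d). E ^ f z)
      = u * (\<Sum>a<q. real (n b) * (\<Sum>x\<in>words q d. E ^ h a x))"
    unfolding cS by (simp add: sum_distrib_left mult_ac)
  also have "\<dots> \<le> u * (\<Sum>a<q. N * (1 + E - E * p a))"
    using row u by (intro mult_left_mono sum_mono) auto
  also have "(\<Sum>a<q. N * (1 + E - E * p a)) = N * (\<Sum>a<q. 1 + E - E * p a)"
    by (rule sum_distrib_left[symmetric])
  also have "(\<Sum>a<q. 1 + E - E * p a) = real q * (1 + E) - E * u"
    unfolding u_def sum_subtractf by (simp add: sum_distrib_left)
  also have "u * (N * (real q * (1 + E) - E * u)) = N * (u * (real q * (1 + E) - E * u))"
    by simp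
  also have "\<dots> \<le> N * ((real q * (1 + E))\<^sup>2 / (4 * E))"
  proof (intro mult_left_mono N)
    \<comment> \<open>The quadratic in \<open>u\<close> is largest at \<open>u = q * (1 + E) / (2 * E)\<close>.\<close>
    have "0 \<le> (real q * (1 + E) - 2 * E * u)\<^sup>2" by simp
    then have "u * (real q * (1 + E) - E * u) * (4 * E) \<le> (real q * (1 + E))\<^sup>2"
      by (simp add: power2_eq_square algebra_simps)
    then show "u * (real q * (1 + E) - E * u) \<le> (real q * (1 + E))\<^sup>2 / (4 * E)"
      using E by (simp add: pos_le_divide_eq)
  qed
  also have "\<dots> = K ^ Suc d * (real q ^ Suc d)\<^sup>2"
    by (simp add: N_def K_def power_mult_distrib mult_ac)
  finally have "real (card S) * (\<Sum>z\<in>words q (Suc d). E ^ f z) \<le> K ^ Suc d * (real q ^ Suc d)\<^sup>2" .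
  with dist show ?case unfolding K_def by (intro exI[of _ f] conjI ballI) simp_all
qed

text \<open>
Markov's inequality for \<open>E ^ f x\<close>, where \<open>f\<close> is the bound for the distance to \<open>S\<close>.  The length \<open>p * k\<close> makes the
radius \<open>k\<close> a fixed proportion of the length.
\<close>

lemma few_far_words:
  fixes E a :: real
  assumes E: "1 < E" and q: "0 < q" and a: "0 < a"
    and S: "S \<subseteq> words q (p * k)" "real q ^ (p * k) / a ^ k \<le> real (card S)"
    and small: "real q * (a * ((1 + E)\<^sup>2 / (4 * E)) ^ p / E) ^ k < 1"
  shows "real q * real (card {x \<in> words q (p * k). \<forall>y\<in>S. k < hamming (p * k) x y}) < real q ^ (p * k)"
proof -
  define K where "K = (1 + E)\<^sup>2 / (4 * E)"
  define r where "r = real q ^ (p * k)"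
  define Far where "Far = {x \<in> words q (p * k). \<forall>y\<in>S. k < hamming (p * k) x y}"
  have r: "0 < r" using q by (simp add: r_def)
  have "0 < r / a ^ k" using r a by simp
  then have cS: "0 < real (card S)" using S(2) unfolding r_def by (rule less_le_trans)
  then have "S \<noteq> {}" by auto
  then obtain f where f: "\<And>x. x \<in> words q (p * k) \<Longrightarrow> \<exists>y\<in>S. hamming (p * k) x y \<le> f x"
      "real (card S) * (\<Sum>x\<in>words q (p * k). E ^ f x) \<le> K ^ (p * k) * r\<^sup>2"
    using exponential_distance_bound[OF E q S(1)] unfolding K_def r_def by blast
  have "real (card Far) * E ^ k = (\<Sum>x\<in>Far. E ^ k)" by simp
  also have "\<dots> \<le> (\<Sum>x\<in>Far. E ^ f x)"
  proof (intro sum_mono power_increasing)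
    fix x assume "x \<in> Far"
    then show "k \<le> f x" using f(1)[of x] by (fastforce simp: Far_def)
  qed (use E in auto)
  also have "\<dots> \<le> (\<Sum>x\<in>words q (p * k). E ^ f x)"
    using E finite_words by (intro sum_mono2) (auto simp: Far_def)
  finally have "(r / a ^ k) * (real (card Far) * E ^ k) \<le> real (card S) * (\<Sum>x\<in>words q (p * k). E ^ f x)"
    using S(2) E by (intro mult_mono) (auto simp: r_def intro: sum_nonneg)
  also have "\<dots> \<le> K ^ (p * k) * r\<^sup>2" by (rule f(2))
  finally have "r * (real (card Far) * E ^ k) \<le> r * (K ^ (p * k) * r * a ^ k)"
    using a by (simp add: pos_divide_le_eq power2_eq_square mult_ac)
  then have "real (card Far) * E ^ k \<le> K ^ (p * k) * r * a ^ k"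
    using r by simp
  then have "real (card Far) \<le> K ^ (p * k) * r * a ^ k / E ^ k"
    using E by (simp add: pos_le_divide_eq)
  also have "\<dots> = r * (a * K ^ p / E) ^ k"
    by (simp add: power_mult power_mult_distrib power_divide)
  finally have "real q * real (card Far) \<le> real q * (r * (a * K ^ p / E) ^ k)"
    by (rule mult_left_mono) simp
  also have "\<dots> = r * (real q * (a * K ^ p / E) ^ k)" by simp
  also have "\<dots> < r * 1" using small r unfolding K_def by (intro mult_strict_left_mono) auto
  finally show ?thesis by (simp add: Far_def r_def)
qed

lemma mod_add_inj:
  fixes x y i q :: nat
  assumes "x < q" "y < q" "(x + i) mod q = (y + i) mod q"
  shows "x = y"
proof -
  have "v = u" if "u \<le> v" "v < q" "(u + i) mod q = (v + i) mod q" for u v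
  proof -
    have "q dvd (v + i) - (u + i)" using that by (subst mod_eq_dvd_iff_nat[symmetric]) auto
    then show ?thesis using that by (auto dest: dvd_imp_le)
  qed
  then show ?thesis using assms by (metis nat_le_linear)
qed

text \<open>
Take a random word \<open>x\<close> and its cyclic shifts, in which \<open>i\<close> is added to each letter.  Different shifts agree
nowhere, and each shift is a uniformly random word, so with positive probability the \<open>i\<close>-th shift is within distance \<open>k\<close> of
the \<open>i\<close>-th set for all \<open>i\<close>.  Replacing shifts by near words in the sets creates at most \<open>2 * k\<close> agreements for each pair.
\<close>

lemma rich_words:
  fixes E a :: real
  assumes E: "1 < E" and q: "0 < q" and a: "0 < a" and t: "t \<le> q"
    and small: "real q * (a * ((1 + E)\<^sup>2 / (4 * E)) ^ p / E) ^ k < 1"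
  shows "rich (real q ^ (p * k) / a ^ k) (words q (p * k)) t {as. sorted_wrt (\<lambda>x y. agree (p * k) x y \<le> 2 * k) as}"
  unfolding rich_def
proof (intro allI impI)
  fix Ss assume len: "length Ss = t" and Ss: "\<forall>S\<in>set Ss. S \<subseteq> words q (p * k) \<and> real q ^ (p * k) / a ^ k \<le> real (card S)"
  define d where "d = p * k"
  define W where "W = words q d"
  define shift where "shift i = map (\<lambda>c. (c + i) mod q)" for i :: nat
  define Far where "Far i = {x \<in> W. \<forall>y\<in>Ss ! i. k < hamming d x y}" for i
  define Bad where "Bad i = {x \<in> W. shift i x \<in> Far i}" for i
  have far: "real q * real (card (Far i)) < real q ^ d" if "i < t" for i
    unfolding Far_def W_def d_def using Ss len that by (intro few_far_words[OF E q a _ _ small]) auto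
  have shift_W: "shift i x \<in> W" if "x \<in> W" for i x
    using that q by (auto simp: W_def in_words_iff shift_def)
  have bad: "card (Bad i) \<le> card (Far i)" for i
  proof (rule card_inj_on_le)
    show "inj_on (shift i) (Bad i)"
    proof (rule inj_onI)
      fix x y assume xy: "x \<in> Bad i" "y \<in> Bad i" "shift i x = shift i y"
      show "x = y"
      proof (rule nth_equalityI)
        show "length x = length y" using xy by (auto simp: Bad_def W_def in_words_iff)
        fix j assume j: "j < length x"
        have "x ! j < q" "y ! j < q" "j < length y"
          using xy j by (auto simp: Bad_def W_def in_words_iff)
        moreover have "(x ! j + i) mod q = (y ! j + i) mod q"
          using arg_cong[OF xy(3), of "\<lambda>z. z ! j"] j \<open>j < length y\<close> by (simp add: shift_def)
        ultimately show "x ! j = y ! j"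
          by (auto intro: mod_add_inj)
      qed
    qed
    show "shift i ` Bad i \<subseteq> Far i" by (auto simp: Bad_def)
    show "finite (Far i)" using finite_words by (simp add: Far_def W_def)
  qed
  have "\<exists>x\<in>W. \<forall>i<t. x \<notin> Bad i"
  proof (rule ccontr)
    assume "\<not> ?thesis"
    then have "W \<subseteq> (\<Union>i<t. Bad i)" by auto
    then have "card W \<le> card (\<Union>i<t. Bad i)"
      using finite_words by (intro card_mono) (auto simp: Bad_def W_def)
    also have "\<dots> \<le> (\<Sum>i<t. card (Bad i))" by (rule card_UN_le) simp
    also have "\<dots> \<le> (\<Sum>i<t. card (Far i))" by (intro sum_mono bad)
    finally have le: "real q ^ d \<le> (\<Sum>i<t. real (card (Far i)))"
      by (simp add: W_def card_words flip: of_nat_sum of_nat_power)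
    show False
    proof (cases "t = 0")
      case True
      then have "real q ^ d \<le> 0" using le by simp
      moreover have "0 < real q ^ d" using q by (intro zero_less_power) simp
      ultimately show False by linarith
    next
      case False
      have "real q * real q ^ d \<le> (\<Sum>i<t. real q * real (card (Far i)))"
        using le q by (simp flip: sum_distrib_left)
      also have "\<dots> < (\<Sum>i<t. real q ^ d)"
        using False far by (intro sum_strict_mono) auto
      also have "\<dots> \<le> real q * real q ^ d" using t by (simp add: mult_right_mono)
      finally show False by simp
    qed
  qed
  then obtain x where x: "x \<in> W" "\<And>i. i < t \<Longrightarrow> x \<notin> Bad i" by blast
  have "\<forall>i<t. \<exists>y\<in>Ss ! i. hamming d (shift i x) y \<le> k"
    using x shift_W by (force simp: Bad_def Far_def)
  then obtain y where y: "\<And>i. i < t \<Longrightarrow> y i \<in> Ss ! i \<and> hamming d (shift i x) (y i) \<le> k"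
    by metis
  have "map y [0..<t] \<in> listset Ss"
    using y len by (auto simp: in_listset_iff list_all2_conv_all_nth)
  moreover have "agree d (y i) (y j) \<le> 2 * k" if "i < j" "j < t" for i j
  proof -
    have "(c + i) mod q \<noteq> (c + j) mod q" for c
    proof
      assume "(c + i) mod q = (c + j) mod q"
      then have "i = j" using that t mod_add_inj[of i q j c] by (simp add: add.commute)
      then show False using that by simp
    qed
    then have "agree d (shift i x) (shift j x) = 0"
      using x(1) by (auto simp: agree_def shift_def W_def in_words_iff)
    then show ?thesis
      using agree_triangle[of d "y i" "y j" "shift i x" "shift j x"] y[of i] y[of j] that by simp
  qed
  ultimately show "listset Ss \<inter> {as. sorted_wrt (\<lambda>x y. agree (p * k) x y \<le> 2 * k) as} \<noteq> {}"
    by (auto simp: sorted_wrt_iff_nth_less d_def intro!: exI[of _ "map y [0..<t]"])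
qed

lemma agree_eq_sum: "agree d x y = (\<Sum>i<d. if x ! i = y ! i then 1 else 0)"
proof -
  have "agree d x y = (\<Sum>i | i \<in> {..<d} \<and> x ! i = y ! i. 1)" by (simp add: agree_def)
  also have "\<dots> = (\<Sum>i<d. if x ! i = y ! i then 1 else 0)" by (rule sum.inter_filter) simp
  finally show ?thesis .
qed

text \<open>
In each of the \<open>3 * s\<^sup>2 * k\<close> positions two of the \<open>s\<close> words agree, because there are fewer than \<open>s\<close> letters.  Distributing
these agreements over fewer than \<open>s\<^sup>2\<close> ordered pairs gives a pair with more than \<open>2 * k\<close> of them.
\<close>

lemma no_large_clique_words:
  assumes T: "T \<subseteq> words q (3 * s\<^sup>2 * k)" "card T = s" and q: "q < s" and k: "0 < k"
  shows "\<exists>x\<in>T. \<exists>y\<in>T. x \<noteq> y \<and> 2 * k < agree (3 * s\<^sup>2 * k) x y"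
proof (rule ccontr)
  define d where "d = 3 * s\<^sup>2 * k"
  assume "\<not> ?thesis"
  then have small: "agree d x y \<le> 2 * k" if "x \<in> T" "y \<in> T" "x \<noteq> y" for x y
    using that by (force simp: d_def)
  define P where "P = {(x, y) \<in> T \<times> T. x \<noteq> y}"
  have finT: "finite T" using T q card.infinite by fastforce
  have finP: "finite P" using finT by (auto simp: P_def intro: finite_subset[of _ "T \<times> T"])
  have "card P \<le> card (T \<times> T)" using finT by (intro card_mono) (auto simp: P_def)
  then have cardP: "card P \<le> s\<^sup>2" using T(2) by (simp add: card_cartesian_product power2_eq_square)
  have hit: "1 \<le> (\<Sum>(x, y)\<in>P. if x ! i = y ! i then 1 else 0 :: nat)" if "i < d" for i
  proof -
    have "(\<lambda>x. x ! i) ` T \<subseteq> {..<q}" using T(1) that by (auto simp: in_words_iff d_def)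
    then have "\<not> inj_on (\<lambda>x. x ! i) T"
      using T(2) q by (metis card_inj_on_le card_lessThan finite_lessThan not_less)
    then obtain x y where "x \<in> T" "y \<in> T" "x \<noteq> y" "x ! i = y ! i" by (auto simp: inj_on_def)
    then show ?thesis
      using finP member_le_sum[of "(x, y)" P "\<lambda>(x, y). if x ! i = y ! i then 1 else 0 :: nat"]
      by (auto simp: P_def)
  qed
  have "d = (\<Sum>i<d. 1)" by simp
  also have "\<dots> \<le> (\<Sum>i<d. \<Sum>(x, y)\<in>P. if x ! i = y ! i then 1 else 0 :: nat)"
    using hit by (intro sum_mono) auto
  also have "\<dots> = (\<Sum>(x, y)\<in>P. \<Sum>i<d. if x ! i = y ! i then 1 else 0 :: nat)"
    unfolding case_prod_beta by (rule sum.swap)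
  also have "\<dots> = (\<Sum>(x, y)\<in>P. agree d x y)"
    by (simp add: agree_eq_sum)
  also have "\<dots> \<le> (\<Sum>(x, y)\<in>P. 2 * k)"
    using small by (intro sum_mono) (auto simp: P_def)
  also have "\<dots> \<le> s\<^sup>2 * (2 * k)" using cardP by (simp add: case_prod_beta)
  finally have "3 * (s\<^sup>2 * k) \<le> 2 * (s\<^sup>2 * k)" unfolding d_def by (simp only: mult_ac)
  moreover have "0 < s\<^sup>2 * k" using q k by simp
  ultimately show False by linarith
qed

text \<open>
With \<open>E = 1 + \<tau>\<close> the base of \<open>exponential_distance_bound\<close> is \<open>1 + O(\<tau>\<^sup>2)\<close>, while the gain per unit of distance is
\<open>1 + \<tau>\<close>; for \<open>\<tau> = 1 / p\<close> the gain still wins after \<open>p\<close> positions, and \<open>a\<close> uses up the remaining room.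
\<close>

lemma exponent_parameters:
  assumes "0 < (p::nat)"
  shows "\<exists>E a :: real. 1 < E \<and> 1 < a \<and> a * ((1 + E)\<^sup>2 / (4 * E)) ^ p < E"
proof -
  define \<tau> where "\<tau> = 1 / real p"
  define E where "E = 1 + \<tau>"
  define K where "K = (1 + E)\<^sup>2 / (4 * E)"
  have \<tau>: "0 < \<tau>" "\<tau> \<le> 1" "real p * \<tau> = 1" using assms by (auto simp: \<tau>_def)
  have K1: "1 \<le> K"
    using \<tau> by (simp add: K_def E_def power2_eq_square field_simps)
  have "K = 1 + \<tau>\<^sup>2 / (4 * E)"
    using \<tau> by (simp add: K_def E_def power2_eq_square field_simps)
  also have "\<dots> \<le> 1 + \<tau>\<^sup>2 / 4"
    using \<tau> by (intro add_left_mono divide_left_mono) (auto simp: E_def)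
  also have "\<dots> \<le> exp (\<tau>\<^sup>2 / 4)" by (rule exp_ge_add_one_self)
  finally have "K ^ p \<le> exp (\<tau>\<^sup>2 / 4) ^ p" using K1 by (intro power_mono) auto
  also have "\<dots> = exp (\<tau> / 4)"
    using \<tau>(3) by (simp add: power2_eq_square flip: exp_of_nat_mult)
  also have "\<dots> \<le> 1 + \<tau> / 4 + (\<tau> / 4)\<^sup>2" using \<tau> by (intro exp_bound) auto
  also have "\<dots> < E"
  proof -
    have "(\<tau> / 4)\<^sup>2 \<le> \<tau> / 4 * 1" unfolding power2_eq_square using \<tau> by (intro mult_left_mono) auto
    then show ?thesis using \<tau> by (simp add: E_def)
  qed
  finally have "K ^ p < E" .
  moreover have Kp: "0 < K ^ p" using K1 by simp
  ultimately have "1 < E / K ^ p" by simp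
  then obtain a where "1 < a" "a < E / K ^ p" using dense by blast
  then show ?thesis using Kp \<tau> by (intro exI[of _ E] exI[of _ a]) (auto simp: K_def E_def field_simps)
qed

text \<open>
Here \<open>r = Q ^ k\<close>, so that \<open>r / a ^ k\<close> is a power of \<open>r\<close> with exponent less than \<open>1\<close>.
\<close>

lemma colour_graph_exists:
  assumes s: "3 \<le> s"
  shows "\<exists>(Q::nat) a::real. 2 \<le> Q \<and> 1 < a \<and> (\<forall>\<^sub>F k in sequentially.
    \<exists>(R :: nat list set) adj. card R = Q ^ k \<and> symp adj \<and> irreflp adj \<and>
      (\<forall>T\<subseteq>R. card T = s \<longrightarrow> (\<exists>x\<in>T. \<exists>y\<in>T. x \<noteq> y \<and> \<not> adj x y)) \<and>
      (\<forall>t<s. rich (real Q ^ k / a ^ k) R t {as. sorted_wrt adj as}))"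
proof -
  define p where "p = 3 * s\<^sup>2"
  define q where "q = s - 1"
  have q: "2 \<le> q" "q < s" using s by (auto simp: q_def)
  have "0 < p" using s by (simp add: p_def)
  then obtain E a :: real where Ea: "1 < E" "1 < a" "a * ((1 + E)\<^sup>2 / (4 * E)) ^ p < E"
    using exponent_parameters by blast
  define b where "b = a * ((1 + E)\<^sup>2 / (4 * E)) ^ p / E"
  have b: "0 \<le> b" "b < 1" using Ea by (auto simp: b_def)
  then have "(\<lambda>k. real q * b ^ k) \<longlonglongrightarrow> real q * 0"
    by (intro tendsto_mult_left LIMSEQ_realpow_zero) auto
  then have "\<forall>\<^sub>F k in sequentially. real q * b ^ k < 1"
    by (rule order_tendstoD) simp
  then have ev: "\<forall>\<^sub>F k in sequentially. real q * b ^ k < 1 \<and> 0 < k"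
    using eventually_gt_at_top[of 0] by eventually_elim simp
  have "\<exists>(R :: nat list set) adj. card R = (q ^ p) ^ k \<and> symp adj \<and> irreflp adj \<and>
      (\<forall>T\<subseteq>R. card T = s \<longrightarrow> (\<exists>x\<in>T. \<exists>y\<in>T. x \<noteq> y \<and> \<not> adj x y)) \<and>
      (\<forall>t<s. rich (real (q ^ p) ^ k / a ^ k) R t {as. sorted_wrt adj as})"
    if k: "real q * b ^ k < 1 \<and> 0 < k" for k
  proof (intro exI[of _ "words q (p * k)"] exI[of _ "\<lambda>x y. agree (p * k) x y \<le> 2 * k"] conjI allI impI)
    show "card (words q (p * k)) = (q ^ p) ^ k" by (simp add: card_words power_mult)
    show "symp (\<lambda>x y. agree (p * k) x y \<le> 2 * k)"
      by (auto simp: symp_def agree_def eq_commute)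
    show "irreflp (\<lambda>x y. agree (p * k) x y \<le> 2 * k)"
    proof (rule irreflpI)
      fix x
      have "1 * 1 \<le> s * s" using s by (intro mult_le_mono) auto
      then have "2 < p" unfolding p_def power2_eq_square by linarith
      then have "2 * k < p * k" using k by simp
      then show "\<not> agree (p * k) x x \<le> 2 * k" by (simp add: agree_def)
    qed
    fix T assume T: "T \<subseteq> words q (p * k)" "card T = s"
    show "\<exists>x\<in>T. \<exists>y\<in>T. x \<noteq> y \<and> \<not> agree (p * k) x y \<le> 2 * k"
      using no_large_clique_words[of T q s k] T q k by (auto simp: p_def not_le)
  next
    fix t assume "t < s"
    then show "rich (real (q ^ p) ^ k / a ^ k) (words q (p * k)) t {as. sorted_wrt (\<lambda>x y. agree (p * k) x y \<le> 2 * k) as}"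
      using rich_words[of E q a t p k] Ea q k by (simp add: b_def power_mult q_def)
  qed
  moreover have "2 \<le> q ^ p" using q \<open>0 < p\<close> by (metis One_nat_def Suc_leI dual_order.trans less_le_trans pos2 power_increasing power_one_right)
  ultimately show ?thesis
    using Ea(2) ev by (intro exI[of _ "q ^ p"] exI[of _ a]) (auto elim: eventually_mono)
qed

section \<open>Covering tuples block by block\<close>

text \<open>
The tuples covered after the next block, if \<open>S\<close> was covered before and \<open>K\<close> is chosen in the block: the graph of
edges with first vertex \<open>v\<close> is the pullback of \<open>adj\<close> along \<open>\<chi> v\<close>.
\<close>

definition extend :: "('c \<Rightarrow> 'c \<Rightarrow> bool) \<Rightarrow> ('a \<Rightarrow> 'a \<Rightarrow> 'c) \<Rightarrow> 'a list set \<Rightarrow> 'a set \<Rightarrow> 'a list set" where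
  "extend adj \<chi> S K = {xs. \<exists>v\<in>K. v # xs \<in> S \<and> sorted_wrt adj (map (\<chi> v) xs)}"

text \<open>
The tuples newly covered by adding \<open>v\<close> to \<open>K\<close> are the hits of \<open>\<chi> v\<close> in this set, which does not depend on \<open>\<chi> v\<close>
as long as \<open>v\<close> has not been chosen.
\<close>

definition open_at :: "('c \<Rightarrow> 'c \<Rightarrow> bool) \<Rightarrow> ('a \<Rightarrow> 'a \<Rightarrow> 'c) \<Rightarrow> 'a list set \<Rightarrow> 'a set \<Rightarrow> 'a \<Rightarrow> 'a list set" where
  "open_at adj \<chi> S K v = slice S v - extend adj \<chi> S K"

lemma extend_insert:
  "extend adj \<chi> S (insert v K) = extend adj \<chi> S K \<union> hits {as. sorted_wrt adj as} (open_at adj \<chi> S K v) (\<chi> v)"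
  by (auto simp: extend_def hits_def open_at_def slice_def)

lemma extend_subset: "S \<subseteq> listset (F # Fs) \<Longrightarrow> extend adj \<chi> S K \<subseteq> listset Fs"
  by (auto simp: extend_def set_Cons_def)

lemma slice_subset: "S \<subseteq> listset (F # Fs) \<Longrightarrow> slice S v \<subseteq> listset Fs"
  by (auto simp: slice_def set_Cons_def)

text \<open>
One step of the covering.  Let \<open>K\<close> minimise the number of uncovered tuples plus \<open>\<theta> * \<mu> ^ t\<close> for each element.
Comparison with the empty set bounds the size of \<open>K\<close> by \<open>1 / \<theta>\<close>, and comparison with \<open>insert v K\<close>
shows that every further \<open>v\<close> covers at most \<open>\<theta> * \<mu> ^ t\<close> new tuples.  By Markov's inequality, for at most half of the
vertices more than \<open>2 * \<delta> * \<mu> ^ t\<close> tuples are missing from their slice of \<open>S\<close>; the remaining ones outside \<open>K\<close>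
would all be stuck if too many tuples were uncovered.
\<close>

lemma extend_or_stuck:
  fixes \<delta> \<kappa> \<theta> :: real
  assumes A: "finite A" and bl: "blocks A \<mu> (F # Fs)" and t: "length Fs = t" and \<mu>: "0 < \<mu>"
    and S: "S \<subseteq> listset (F # Fs)" "real (card (listset (F # Fs) - S)) \<le> \<delta> * real \<mu> ^ Suc t"
    and pos: "0 < \<delta>" "0 < \<theta>" "0 < \<kappa>" and \<theta>: "1 / \<theta> \<le> real \<mu> / 4" and m: "real m \<le> real \<mu> / 4"
    and not_stuck: "\<And>K B. K \<subseteq> F \<Longrightarrow> B \<subseteq> F - K \<Longrightarrow> card B = m \<Longrightarrow>
      \<exists>v\<in>B. 4 * \<kappa> * 2 ^ t * real \<mu> ^ t \<le> real (card (open_at adj \<chi> S K v)) \<longrightarrow>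
        \<theta> * real \<mu> ^ t < real (card (hits {as. sorted_wrt adj as} (open_at adj \<chi> S K v) (\<chi> v)))"
  shows "\<exists>K\<subseteq>F. real (card (listset Fs - extend adj \<chi> S K)) \<le> (4 * \<kappa> * 2 ^ t + 2 * \<delta>) * real \<mu> ^ t"
proof -
  define M where "M = real \<mu> ^ t"
  define Z where "Z K = listset Fs - extend adj \<chi> S K" for K
  define pot where "pot K = real (card (Z K)) + \<theta> * M * real (card K)" for K
  have M: "0 < M" using \<mu> by (simp add: M_def)
  have F: "F \<subseteq> A" "card F = \<mu>" and bl': "blocks A \<mu> Fs" using bl by (auto simp: blocks_Cons)
  have finF: "finite F" using F A finite_subset by blast
  have finL: "finite (listset Fs)" by (rule blocks_finite_listset[OF A bl'])
  have cL: "real (card (listset Fs)) = M" using blocks_card_listset[OF bl'] t by (simp add: M_def)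
  have finZ: "finite (Z K)" for K using finL by (simp add: Z_def)
  obtain K where K: "K \<subseteq> F" "\<And>K'. K' \<subseteq> F \<Longrightarrow> pot K \<le> pot K'"
    using ex_is_arg_min_if_finite[of "Pow F" pot] finF by (auto simp: is_arg_min_linorder)
  have finK: "finite K" using K finF finite_subset by blast
  have "pot K \<le> pot {}" using K by simp
  also have "\<dots> \<le> M" using card_mono[OF finL, of "Z {}"] by (simp add: pot_def Z_def flip: cL)
  finally have "M * (\<theta> * real (card K)) \<le> M * 1" by (simp add: pot_def mult_ac)
  then have "\<theta> * real (card K) \<le> 1" using M by simp
  then have cK: "real (card K) \<le> real \<mu> / 4"
    using \<theta> pos by (smt (verit) mult.commute pos_le_divide_eq)
  have few: "real (card (hits {as. sorted_wrt adj as} (open_at adj \<chi> S K v) (\<chi> v))) \<le> \<theta> * M" if v: "v \<in> F - K" for v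
  proof -
    define H where "H = hits {as. sorted_wrt adj as} (open_at adj \<chi> S K v) (\<chi> v)"
    have H: "H \<subseteq> Z K" using slice_subset[OF S(1), of v] by (auto simp: H_def hits_def open_at_def Z_def)
    have "Z (insert v K) = Z K - H" unfolding Z_def extend_insert H_def by auto
    then have "card (Z (insert v K)) + card H = card (Z K)"
      using H finZ by (simp add: card_Diff_subset finite_subset card_mono)
    moreover have "pot K \<le> pot (insert v K)" using K v by simp
    ultimately show ?thesis
      using v finK by (simp add: pot_def H_def[symmetric] algebra_simps)
  qed
  have "real (card (Z K)) \<le> (4 * \<kappa> * 2 ^ t + 2 * \<delta>) * M"
  proof (rule ccontr)
    assume "\<not> ?thesis"
    then have big: "(4 * \<kappa> * 2 ^ t + 2 * \<delta>) * M < real (card (Z K))" by simp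
    define miss where "miss v = listset Fs - slice S v" for v
    define P where "P = {v \<in> F. 2 * \<delta> * M < real (card (miss v))}"
    have finP: "finite P" using finF by (simp add: P_def)
    have miss_eq: "slice (listset (F # Fs) - S) v = miss v" if "v \<in> F" for v
      using that by (auto simp: slice_def miss_def in_listset_Cons simp del: listset.simps)
    have "real (card P) * (2 * \<delta> * M) \<le> (\<Sum>v\<in>P. real (card (miss v)))"
      using sum_mono[of P "\<lambda>_. 2 * \<delta> * M" "\<lambda>v. real (card (miss v))"] by (simp add: P_def)
    also have "\<dots> \<le> (\<Sum>v\<in>F. real (card (miss v)))"
      using finF by (intro sum_mono2) (auto simp: P_def)
    also have "\<dots> = real (card (listset (F # Fs) - S))"
    proof -
      have "card (listset (F # Fs) - S) = (\<Sum>v\<in>F. card (slice (listset (F # Fs) - S) v))"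
        using blocks_finite_listset[OF A bl] by (intro card_eq_sum_slices[OF finF]) (auto simp del: listset.simps)
      then show ?thesis by (simp add: miss_eq del: listset.simps)
    qed
    also have "\<dots> \<le> (real \<mu> / 2) * (2 * \<delta> * M)" using S(2) by (simp add: M_def mult_ac)
    finally have cP: "real (card P) \<le> real \<mu> / 2" using pos M by simp
    have "card F \<le> card (F - P - K) + card (P \<union> K)"
      using card_mono[of "(F - P - K) \<union> (P \<union> K)" F] card_Un_le[of "F - P - K" "P \<union> K"] finF finP finK by force
    also have "card (P \<union> K) \<le> card P + card K" by (rule card_Un_le)
    finally have "real \<mu> \<le> real (card (F - P - K)) + (real (card P) + real (card K))"
      using F(2) by (simp flip: of_nat_add)
    then have "real m \<le> real (card (F - P - K))" using cP cK m by simp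
    then obtain B where B: "B \<subseteq> F - P - K" "card B = m"
      using obtain_subset_with_card_n[of m "F - P - K"] by auto
    obtain v where v: "v \<in> B" "4 * \<kappa> * 2 ^ t * M \<le> real (card (open_at adj \<chi> S K v)) \<longrightarrow>
        \<theta> * M < real (card (hits {as. sorted_wrt adj as} (open_at adj \<chi> S K v) (\<chi> v)))"
      using not_stuck[OF K(1), of B] B unfolding M_def by blast
    have "Z K \<subseteq> open_at adj \<chi> S K v \<union> miss v"
      by (auto simp: Z_def open_at_def miss_def)
    moreover have "finite (open_at adj \<chi> S K v \<union> miss v)"
      using slice_subset[OF S(1), of v] finL by (auto simp: open_at_def miss_def intro: finite_subset)
    ultimately have "card (Z K) \<le> card (open_at adj \<chi> S K v) + card (miss v)"
      using card_mono card_Un_le le_trans by metis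
    then have "real (card (Z K)) \<le> real (card (open_at adj \<chi> S K v)) + real (card (miss v))"
      by (simp flip: of_nat_add)
    moreover have "real (card (miss v)) \<le> 2 * \<delta> * M" using v B by (auto simp: P_def not_less)
    ultimately have "4 * \<kappa> * 2 ^ t * M \<le> real (card (open_at adj \<chi> S K v))"
      using big by (simp add: algebra_simps)
    then show False using v few[of v] B by auto
  qed
  then show ?thesis using K(1) by (auto simp: Z_def M_def)
qed

section \<open>A colouring without stuck configurations\<close>

lemma extend_cong:
  assumes "\<And>v. v \<in> K \<Longrightarrow> \<chi> v = \<chi>' v"
  shows "extend adj \<chi> S K = extend adj \<chi>' S K"
  using assms by (auto simp: extend_def)

lemma foldl_extend_cong:
  assumes "\<And>v. v \<in> \<Union> (set Ks) \<Longrightarrow> \<chi> v = \<chi>' v"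
  shows "foldl (extend adj \<chi>) S Ks = foldl (extend adj \<chi>') S Ks"
  using assms
proof (induction Ks arbitrary: S)
  case (Cons K Ks)
  have "extend adj \<chi> S K = extend adj \<chi>' S K" using Cons.prems by (intro extend_cong) auto
  then show ?case using Cons by simp
qed simp

lemma foldl_extend_subset:
  "length Ks \<le> length Fs \<Longrightarrow> S \<subseteq> listset Fs \<Longrightarrow> foldl (extend adj \<chi>) S Ks \<subseteq> listset (drop (length Ks) Fs)"
proof (induction Ks arbitrary: S Fs)
  case (Cons K Ks)
  then obtain F Fs' where Fs: "Fs = F # Fs'" by (cases Fs) auto
  have "extend adj \<chi> S K \<subseteq> listset Fs'" using Cons.prems Fs extend_subset by metis
  then show ?case using Cons Fs by simp
qed simp

text \<open>
The event to be avoided, for sets \<open>Ks\<close> chosen from the first blocks, and \<open>K\<close> and \<open>B\<close> inside the next block.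
It is formulated for arbitrary sets, because the minimising \<open>K\<close> of \<open>extend_or_stuck\<close> depends on the colouring, while
the union bound needs events that are given in advance.
\<close>

definition stuck :: "('c \<Rightarrow> 'c \<Rightarrow> bool) \<Rightarrow> real \<Rightarrow> real \<Rightarrow> nat \<Rightarrow> 'a set list \<Rightarrow> 'a set list \<Rightarrow> 'a set \<Rightarrow> 'a set \<Rightarrow> ('a \<Rightarrow> 'a \<Rightarrow> 'c) \<Rightarrow> bool" where
  "stuck adj \<kappa> \<theta> \<mu> Fs Ks K B \<chi> \<longleftrightarrow>
    (let S = foldl (extend adj \<chi>) (listset Fs) Ks; t = length Fs - Suc (length Ks) in
     \<forall>v\<in>B. 4 * \<kappa> * 2 ^ t * real \<mu> ^ t \<le> real (card (open_at adj \<chi> S K v)) \<and>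
       real (card (hits {as. sorted_wrt adj as} (open_at adj \<chi> S K v) (\<chi> v))) \<le> \<theta> * real \<mu> ^ t)"

lemma blocks_drop: "blocks A \<mu> Fs \<Longrightarrow> blocks A \<mu> (drop j Fs)"
  unfolding blocks_def by (auto dest: in_set_dropD simp: sorted_wrt_drop)

text \<open>
The tuples open at \<open>v \<in> B\<close> are determined by the colours at the chosen vertices, which are not in \<open>B\<close>.  Hence
\<open>card_PiE_conditional_le\<close> multiplies the bounds of \<open>few_hits_rare\<close> over all \<open>v \<in> B\<close>.
\<close>

lemma stuck_rare:
  fixes A :: "'a set" and R :: "'c set" and \<kappa> \<rho> \<theta> :: real
  assumes A: "finite A" and R: "finite R" "R \<noteq> {}" and \<kappa>: "0 < \<kappa>" "\<kappa> \<le> 1"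
    and \<mu>: "real b \<le> \<kappa> * real \<mu>" "0 < \<mu>" and \<rho>: "0 \<le> \<rho>"
    and rich: "\<And>t. t < s \<Longrightarrow> rich \<rho> R t {as. sorted_wrt adj as}"
    and \<theta>: "\<theta> \<le> (\<kappa> / real (card R)) ^ s / 2"
    and bl: "blocks A \<mu> Fs" "length Fs = s" and Ks: "length Ks < s"
    and B: "B \<subseteq> A" "\<Union> (set Ks) \<union> K \<subseteq> A - B"
  shows "real (card {\<chi> \<in> PiE A (\<lambda>_. PiE A (\<lambda>_. R)). stuck adj \<kappa> \<theta> \<mu> Fs Ks K B \<chi>})
     \<le> (real s * (real \<mu> * 2 ^ card R) ^ s * (2 ^ \<mu> * (\<rho> / real (card R)) ^ b)) ^ card B
        * real (card (PiE A (\<lambda>_. R))) ^ card A"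
proof -
  define \<Omega> where "\<Omega> = PiE A (\<lambda>_. R)"
  define r where "r = real (card R)"
  define t where "t = length Fs - Suc (length Ks)"
  define S where "S \<chi> = foldl (extend adj \<chi>) (listset Fs) Ks" for \<chi>
  define Op where "Op \<chi> v = open_at adj \<chi> (S \<chi>) K v" for \<chi> v
  define X where "X v \<chi> = {\<phi> \<in> \<Omega>. 4 * \<kappa> * 2 ^ t * real \<mu> ^ t \<le> real (card (Op \<chi> v)) \<and>
       real (card (hits {as. sorted_wrt adj as} (Op \<chi> v) \<phi>)) \<le> \<theta> * real \<mu> ^ t}" for v \<chi>
  define \<beta> where "\<beta> = real s * (real \<mu> * 2 ^ card R) ^ s * (2 ^ \<mu> * (\<rho> / r) ^ b)"
  have r: "1 \<le> r" using R by (simp add: r_def Suc_le_eq card_gt_0_iff)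
  have \<beta>: "0 \<le> \<beta>" using \<rho> by (simp add: \<beta>_def r_def)
  have t: "t < s" using bl Ks by (simp add: t_def)
  have fin\<Omega>: "finite \<Omega>" unfolding \<Omega>_def using A R by (intro finite_PiE) auto
  have card\<Omega>: "real (card \<Omega>) = r ^ card A" unfolding \<Omega>_def r_def using A by (simp add: card_PiE)
  define F where "F = Fs ! length Ks"
  define Fs' where "Fs' = drop (Suc (length Ks)) Fs"
  have dropF: "drop (length Ks) Fs = F # Fs'"
    using bl Ks by (simp add: F_def Fs'_def Cons_nth_drop_Suc)
  have len': "length Fs' = t" by (simp add: Fs'_def t_def)
  have bl': "blocks A \<mu> Fs'" unfolding Fs'_def by (rule blocks_drop[OF bl(1)])
  have "real (card {\<chi> \<in> PiE A (\<lambda>_. \<Omega>). \<forall>v\<in>B. \<chi> v \<in> X v \<chi>}) \<le> \<beta> ^ card B * real (card \<Omega>) ^ card A"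
  proof (rule card_PiE_conditional_le[OF A fin\<Omega> B(1) \<beta>])
    fix v and \<chi> \<chi>' :: "'a \<Rightarrow> 'a \<Rightarrow> 'c"
    assume v: "v \<in> B" and eq: "\<And>x. x \<in> A - B \<Longrightarrow> \<chi> x = \<chi>' x"
    have "S \<chi> = S \<chi>'"
      unfolding S_def using eq B(2) by (intro foldl_extend_cong) blast
    moreover have "extend adj \<chi> S' K = extend adj \<chi>' S' K" for S'
      using eq B(2) by (intro extend_cong) blast
    ultimately have "Op \<chi> v = Op \<chi>' v" by (simp add: Op_def open_at_def)
    then show "X v \<chi> = X v \<chi>'" by (simp add: X_def)
  next
    fix v and \<chi> :: "'a \<Rightarrow> 'a \<Rightarrow> 'c"
    have sub: "Op \<chi> v \<subseteq> listset Fs'"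
    proof -
      have "S \<chi> \<subseteq> listset (F # Fs')"
        unfolding S_def dropF[symmetric] using bl Ks by (intro foldl_extend_subset) auto
      then show ?thesis using slice_subset[of "S \<chi>" F Fs' v] by (auto simp: Op_def open_at_def)
    qed
    have "real (card (X v \<chi>)) \<le> \<beta> * r ^ card A"
    proof (cases "4 * \<kappa> * 2 ^ t * real \<mu> ^ t \<le> real (card (Op \<chi> v))")
      case True
      have "(\<kappa> / r) ^ s \<le> (\<kappa> / r) ^ t"
        using \<kappa> r t by (intro power_decreasing) auto
      then have "\<theta> * real \<mu> ^ t \<le> (\<kappa> / r) ^ t / 2 * real \<mu> ^ t"
        using \<theta> by (intro mult_right_mono) (auto simp: r_def)
      then have "X v \<chi> \<subseteq> {\<phi> \<in> \<Omega>. real (card (hits {as. sorted_wrt adj as} (Op \<chi> v) \<phi>)) \<le> (\<kappa> / r) ^ t / 2 * real \<mu> ^ t}"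
        by (auto simp: X_def)
      then have "real (card (X v \<chi>)) \<le> real (card {\<phi> \<in> \<Omega>. real (card (hits {as. sorted_wrt adj as} (Op \<chi> v) \<phi>)) \<le> (\<kappa> / r) ^ t / 2 * real \<mu> ^ t})"
        using fin\<Omega> by (intro of_nat_mono card_mono) auto
      also have "\<dots> \<le> real t * (real \<mu> * 2 ^ card R) ^ t * (2 ^ \<mu> * (\<rho> / r) ^ b) * r ^ card A"
        unfolding \<Omega>_def r_def
        by (rule few_hits_rare[OF A R \<kappa>(1) \<mu> \<rho> rich[OF t] len' bl' sub True])
      also have "\<dots> \<le> \<beta> * r ^ card A"
      proof -
        have "1 * 1 \<le> real \<mu> * 2 ^ card R" using \<mu> by (intro mult_mono) auto
        then have "(real \<mu> * 2 ^ card R) ^ t \<le> (real \<mu> * 2 ^ card R) ^ s"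
          using t by (intro power_increasing) auto
        then show ?thesis unfolding \<beta>_def using t r \<rho> by (intro mult_right_mono mult_mono) auto
      qed
      finally show ?thesis .
    next
      case False
      then have "X v \<chi> = {}" by (simp add: X_def)
      then show ?thesis using \<beta> r by simp
    qed
    then show "X v \<chi> \<subseteq> \<Omega> \<and> real (card (X v \<chi>)) \<le> \<beta> * real (card \<Omega>)"
      by (auto simp: X_def card\<Omega>)
  qed
  moreover have "{\<chi> \<in> PiE A (\<lambda>_. \<Omega>). stuck adj \<kappa> \<theta> \<mu> Fs Ks K B \<chi>} \<subseteq> {\<chi> \<in> PiE A (\<lambda>_. \<Omega>). \<forall>v\<in>B. \<chi> v \<in> X v \<chi>}"
    using B(1) by (auto simp: stuck_def X_def Op_def S_def t_def Let_def)
  moreover have "finite {\<chi> \<in> PiE A (\<lambda>_. \<Omega>). \<forall>v\<in>B. \<chi> v \<in> X v \<chi>}"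
    using A fin\<Omega> by (intro finite_subset[OF _ finite_PiE[OF A, of "\<lambda>_. \<Omega>"]]) auto
  ultimately have "real (card {\<chi> \<in> PiE A (\<lambda>_. \<Omega>). stuck adj \<kappa> \<theta> \<mu> Fs Ks K B \<chi>}) \<le> \<beta> ^ card B * real (card \<Omega>) ^ card A"
    by (meson card_mono of_nat_mono order_trans)
  then show ?thesis by (simp add: \<Omega>_def \<beta>_def r_def)
qed

text \<open>
The union bound.  The chosen sets are not restricted in size: their number is \<open>2 ^ O(\<mu>)\<close>, which is negligible
against the number of ways to choose the blocks.
\<close>

lemma no_stuck_colouring:
  fixes A :: "'a set" and R :: "'c set" and \<kappa> \<rho> \<theta> :: real
  assumes A: "finite A" and R: "finite R" "R \<noteq> {}" and \<kappa>: "0 < \<kappa>" "\<kappa> \<le> 1"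
    and \<mu>: "real b \<le> \<kappa> * real \<mu>" "0 < \<mu>" and \<rho>: "0 \<le> \<rho>"
    and rich: "\<And>t. t < s \<Longrightarrow> rich \<rho> R t {as. sorted_wrt adj as}"
    and \<theta>: "\<theta> \<le> (\<kappa> / real (card R)) ^ s / 2"
    and num: "real (card A) ^ (\<mu> * s) * (2 ^ (s * \<mu>)) ^ Suc (Suc s) * real (Suc s)
      * (real s * (real \<mu> * 2 ^ card R) ^ s * (2 ^ \<mu> * (\<rho> / real (card R)) ^ b)) ^ m < 1"
  shows "\<exists>\<chi> \<in> PiE A (\<lambda>_. PiE A (\<lambda>_. R)). \<forall>Fs Ks K B.
     blocks A \<mu> Fs \<longrightarrow> length Fs = s \<longrightarrow> length Ks < s \<longrightarrow> \<Union> (set Ks) \<union> K \<union> B \<subseteq> \<Union> (set Fs) \<longrightarrow>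
     card B = m \<longrightarrow> B \<inter> (\<Union> (set Ks) \<union> K) = {} \<longrightarrow> \<not> stuck adj \<kappa> \<theta> \<mu> Fs Ks K B \<chi>"
proof -
  define \<Omega> where "\<Omega> = PiE A (\<lambda>_. PiE A (\<lambda>_. R))"
  define \<beta> where "\<beta> = real s * (real \<mu> * 2 ^ card R) ^ s * (2 ^ \<mu> * (\<rho> / real (card R)) ^ b)"
  define \<F> where "\<F> = {Fs. set Fs \<subseteq> {F. F \<subseteq> A \<and> card F = \<mu>} \<and> length Fs = s}"
  define \<K> where "\<K> U = {Ks. set Ks \<subseteq> Pow U \<and> length Ks \<le> s}" for U :: "'a set"
  define Idx where "Idx = (SIGMA Fs:\<F>. \<K> (\<Union> (set Fs)) \<times> Pow (\<Union> (set Fs)) \<times> Pow (\<Union> (set Fs)))"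
  define Ev where "Ev = (\<lambda>(Fs, Ks, K, B). {\<chi> \<in> \<Omega>. stuck adj \<kappa> \<theta> \<mu> Fs Ks K B \<chi> \<and>
     blocks A \<mu> Fs \<and> length Ks < s \<and> card B = m \<and> B \<inter> (\<Union> (set Ks) \<union> K) = {}})"
  have \<beta>: "0 \<le> \<beta>" using \<rho> by (simp add: \<beta>_def)
  have fin\<Omega>: "finite \<Omega>" unfolding \<Omega>_def using A R by (intro finite_PiE) auto
  have "\<Omega> \<noteq> {}" using R by (auto simp: \<Omega>_def PiE_eq_empty_iff)
  then have pos\<Omega>: "0 < real (card \<Omega>)" using fin\<Omega> by (simp add: card_gt_0_iff)
  have card\<Omega>: "real (card (PiE A (\<lambda>_. R))) ^ card A = real (card \<Omega>)"
    unfolding \<Omega>_def using A by (simp add: card_PiE)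
  have finF: "finite {F. F \<subseteq> A \<and> card F = \<mu>}" using A by simp
  have fin\<F>: "finite \<F>" unfolding \<F>_def by (rule finite_lists_length_eq[OF finF])
  have finU: "finite (\<Union> (set Fs))" and cardU: "card (\<Union> (set Fs)) \<le> s * \<mu>" if "Fs \<in> \<F>" for Fs
  proof -
    show "finite (\<Union> (set Fs))" using that A by (auto simp: \<F>_def intro: finite_subset)
    have "card (\<Union> (set Fs)) \<le> (\<Sum>F\<in>set Fs. card F)" by (rule card_Union_le_sum_card)
    also have "\<dots> = card (set Fs) * \<mu>" using that by (simp add: \<F>_def subset_iff)
    also have "\<dots> \<le> s * \<mu>" using that card_length[of Fs] by (simp add: \<F>_def)
    finally show "card (\<Union> (set Fs)) \<le> s * \<mu>" .
  qed
  have card\<F>: "card \<F> \<le> card A ^ (\<mu> * s)"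
  proof -
    have "card \<F> = (card A choose \<mu>) ^ s"
      unfolding \<F>_def using card_lists_length_eq[OF finF] n_subsets[OF A] by simp
    also have "\<dots> \<le> (card A ^ \<mu>) ^ s"
    proof (rule power_mono)
      show "card A choose \<mu> \<le> card A ^ \<mu>"
        by (cases "\<mu> \<le> card A") (simp_all add: binomial_le_pow binomial_eq_0)
    qed simp
    finally show ?thesis by (simp add: power_mult)
  qed
  have cardJ: "card (\<K> (\<Union> (set Fs)) \<times> Pow (\<Union> (set Fs)) \<times> Pow (\<Union> (set Fs)))
      \<le> Suc s * (2 ^ (s * \<mu>)) ^ Suc (Suc s)" (is "card ?J \<le> _") if "Fs \<in> \<F>" for Fs
  proof -
    define c :: nat where "c = 2 ^ (s * \<mu>)"
    have P: "card (Pow (\<Union> (set Fs))) \<le> c"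
      using finU[OF that] cardU[OF that] by (simp add: card_Pow c_def)
    have "1 \<le> c" by (simp add: c_def)
    have "card (\<K> (\<Union> (set Fs))) = (\<Sum>i\<le>s. card (Pow (\<Union> (set Fs))) ^ i)"
      unfolding \<K>_def using finU[OF that] by (intro card_lists_length_le) simp
    also have "\<dots> \<le> (\<Sum>i\<le>s. c ^ s)"
    proof (rule sum_mono)
      fix i assume "i \<in> {..s}"
      have "card (Pow (\<Union> (set Fs))) ^ i \<le> c ^ i" using P by (rule power_mono) simp
      also have "\<dots> \<le> c ^ s" using \<open>1 \<le> c\<close> \<open>i \<in> {..s}\<close> by (intro power_increasing) auto
      finally show "card (Pow (\<Union> (set Fs))) ^ i \<le> c ^ s" .
    qed
    finally have "card (\<K> (\<Union> (set Fs))) \<le> Suc s * c ^ s" by simp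
    then have "card ?J \<le> (Suc s * c ^ s) * (c * c)"
      unfolding card_cartesian_product using P by (intro mult_le_mono)
    also have "\<dots> = Suc s * c ^ Suc (Suc s)" by (simp only: power_Suc mult_ac)
    finally show ?thesis unfolding c_def .
  qed
  have finJ: "finite (\<K> (\<Union> (set Fs)) \<times> Pow (\<Union> (set Fs)) \<times> Pow (\<Union> (set Fs)))" if "Fs \<in> \<F>" for Fs
    unfolding \<K>_def using finU[OF that]
    by (intro finite_cartesian_product finite_lists_length_le) simp_all
  have finIdx: "finite Idx" unfolding Idx_def using fin\<F> finJ by (rule finite_SigmaI)
  have cardIdx: "card Idx \<le> card A ^ (\<mu> * s) * (Suc s * (2 ^ (s * \<mu>)) ^ Suc (Suc s))"
  proof -
    have "card Idx = (\<Sum>Fs\<in>\<F>. card (\<K> (\<Union> (set Fs)) \<times> Pow (\<Union> (set Fs)) \<times> Pow (\<Union> (set Fs))))"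
      unfolding Idx_def using fin\<F> finJ by (intro card_SigmaI) auto
    also have "\<dots> \<le> (\<Sum>Fs\<in>\<F>. Suc s * (2 ^ (s * \<mu>)) ^ Suc (Suc s))"
      by (rule sum_mono[OF cardJ])
    also have "\<dots> \<le> card A ^ (\<mu> * s) * (Suc s * (2 ^ (s * \<mu>)) ^ Suc (Suc s))"
      unfolding sum_constant of_nat_id using card\<F> by (rule mult_right_mono) simp
    finally show ?thesis .
  qed
  have Ev: "real (card (Ev i)) \<le> \<beta> ^ m * real (card \<Omega>)" if "i \<in> Idx" for i
  proof -
    obtain Fs Ks K B where i: "i = (Fs, Ks, K, B)" by (cases i)
    show ?thesis
    proof (cases "blocks A \<mu> Fs \<and> length Ks < s \<and> card B = m \<and> B \<inter> (\<Union> (set Ks) \<union> K) = {}")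
      case True
      have Fs: "Fs \<in> \<F>" and sub: "set Ks \<subseteq> Pow (\<Union> (set Fs))" "K \<subseteq> \<Union> (set Fs)" "B \<subseteq> \<Union> (set Fs)"
        using that i by (auto simp: Idx_def \<K>_def)
      have "length Fs = s" "\<Union> (set Fs) \<subseteq> A" using Fs by (auto simp: \<F>_def)
      moreover have "\<Union> (set Ks) \<union> K \<union> B \<subseteq> \<Union> (set Fs)" using sub by blast
      ultimately have "length Fs = s" "\<Union> (set Ks) \<union> K \<union> B \<subseteq> A" by (blast, meson order_trans)
      then have "real (card {\<chi> \<in> \<Omega>. stuck adj \<kappa> \<theta> \<mu> Fs Ks K B \<chi>}) \<le> \<beta> ^ card B * real (card \<Omega>)"
        using True unfolding \<Omega>_def \<beta>_def card\<Omega>[unfolded \<Omega>_def, symmetric]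
        by (intro stuck_rare[OF A R \<kappa> \<mu> \<rho> rich \<theta>]) auto
      then show ?thesis using True by (simp add: Ev_def i)
    next
      case False
      then have "Ev i = {}" by (auto simp: Ev_def i)
      then show ?thesis using \<beta> by simp
    qed
  qed
  have "real (card (\<Union>i\<in>Idx. Ev i)) \<le> (\<Sum>i\<in>Idx. real (card (Ev i)))"
    using card_UN_le[OF finIdx, of Ev] by (simp flip: of_nat_sum)
  also have "\<dots> \<le> (\<Sum>i\<in>Idx. \<beta> ^ m * real (card \<Omega>))" by (rule sum_mono[OF Ev])
  also have "\<dots> = real (card Idx) * (\<beta> ^ m * real (card \<Omega>))" by simp
  also have "\<dots> \<le> real (card A ^ (\<mu> * s) * (Suc s * (2 ^ (s * \<mu>)) ^ Suc (Suc s))) * (\<beta> ^ m * real (card \<Omega>))"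
    using \<beta> by (intro mult_right_mono of_nat_mono cardIdx) auto
  also have "\<dots> = (real (card A) ^ (\<mu> * s) * (2 ^ (s * \<mu>)) ^ Suc (Suc s) * real (Suc s) * \<beta> ^ m) * real (card \<Omega>)"
    by (simp only: of_nat_mult of_nat_power of_nat_numeral mult_ac)
  also have "\<dots> < 1 * real (card \<Omega>)"
    using num pos\<Omega> unfolding \<beta>_def[symmetric] by (rule mult_strict_right_mono)
  finally have "card (\<Union>i\<in>Idx. Ev i) < card \<Omega>" by simp
  moreover have "(\<Union>i\<in>Idx. Ev i) \<subseteq> \<Omega>" by (auto simp: Ev_def)
  ultimately obtain \<chi> where \<chi>: "\<chi> \<in> \<Omega>" "\<chi> \<notin> (\<Union>i\<in>Idx. Ev i)" by (metis less_irrefl subsetI subset_antisym)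
  show ?thesis
  proof (intro bexI[of _ \<chi>] allI impI notI)
    fix Fs Ks :: "'a set list" and K B :: "'a set"
    assume *: "blocks A \<mu> Fs" "length Fs = s" "length Ks < s" "\<Union> (set Ks) \<union> K \<union> B \<subseteq> \<Union> (set Fs)"
      "card B = m" "B \<inter> (\<Union> (set Ks) \<union> K) = {}" "stuck adj \<kappa> \<theta> \<mu> Fs Ks K B \<chi>"
    have "\<chi> \<in> Ev (Fs, Ks, K, B)" using * \<chi>(1) by (simp add: Ev_def)
    moreover have "(Fs, Ks, K, B) \<in> Idx"
      using * by (auto simp: Idx_def \<F>_def \<K>_def blocks_def)
    ultimately show False using \<chi>(2) by blast
  qed (use \<chi> in \<open>simp add: \<Omega>_def\<close>)
qed

section \<open>Forward cliques\<close>

text \<open>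
For the empty tuple, the sequence found here spans a complete subgraph of the hypergraph.
\<close>

lemma foldl_extend_linked:
  "xs \<in> foldl (extend adj \<chi>) S Ks \<Longrightarrow> \<exists>vs. length vs = length Ks \<and> vs @ xs \<in> S \<and>
     (\<forall>i<length vs. sorted_wrt adj (map (\<chi> (vs ! i)) (drop (Suc i) (vs @ xs))))"
proof (induction Ks arbitrary: xs rule: rev_induct)
  case (snoc K Ks)
  have "xs \<in> extend adj \<chi> (foldl (extend adj \<chi>) S Ks) K" using snoc.prems by simp
  then obtain v where v: "v # xs \<in> foldl (extend adj \<chi>) S Ks" "sorted_wrt adj (map (\<chi> v) xs)"
    unfolding extend_def by blast
  obtain vs where vs: "length vs = length Ks" "vs @ v # xs \<in> S"
      "\<And>i. i < length vs \<Longrightarrow> sorted_wrt adj (map (\<chi> (vs ! i)) (drop (Suc i) (vs @ v # xs)))"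
    using snoc.IH[OF v(1)] by blast
  show ?case
  proof (intro exI[of _ "vs @ [v]"] conjI allI impI)
    fix i assume i: "i < length (vs @ [v])"
    show "sorted_wrt adj (map (\<chi> ((vs @ [v]) ! i)) (drop (Suc i) ((vs @ [v]) @ xs)))"
    proof (cases "i < length vs")
      case True
      then show ?thesis using vs(3)[OF True] by (simp add: nth_append)
    next
      case False
      then have "i = length vs" using i by simp
      then show ?thesis using v(2) by simp
    qed
  qed (use vs in auto)
qed auto

text \<open>
Iterating \<open>extend_or_stuck\<close> multiplies the bound for the proportion of uncovered tuples by at most \<open>4\<close> in each block.
It starts from the positive value \<open>\<delta>\<close> that the step requires, and stays below \<open>1\<close>, so after the last block the only remaining tuple,
the empty one, is covered.
\<close>

lemma forward_clique_in_blocks: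
  fixes \<kappa> \<theta> :: real
  assumes A: "finite A" and bl: "blocks A \<mu> Fs" "length Fs = s" and \<mu>: "0 < \<mu>"
    and pos: "0 < \<theta>" "0 < \<kappa>" and \<kappa>: "4 * \<kappa> * 8 ^ s < 1"
    and \<theta>: "1 / \<theta> \<le> real \<mu> / 4" and m: "real m \<le> real \<mu> / 4"
    and not_stuck: "\<And>Ks K B. length Ks < s \<Longrightarrow> \<Union> (set Ks) \<union> K \<union> B \<subseteq> \<Union> (set Fs) \<Longrightarrow>
     card B = m \<Longrightarrow> B \<inter> (\<Union> (set Ks) \<union> K) = {} \<Longrightarrow> \<not> stuck adj \<kappa> \<theta> \<mu> Fs Ks K B \<chi>"
  shows "\<exists>vs\<in>listset Fs. \<forall>i<s. sorted_wrt adj (map (\<chi> (vs ! i)) (drop (Suc i) vs))"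
proof -
  define \<delta> where "\<delta> = 4 * \<kappa> * 2 ^ s"
  have \<delta>: "0 < \<delta>" using pos by (simp add: \<delta>_def)
  have "\<exists>Ks. length Ks = j \<and> (\<forall>i<j. Ks ! i \<subseteq> Fs ! i) \<and>
      real (card (listset (drop j Fs) - foldl (extend adj \<chi>) (listset Fs) Ks)) \<le> 4 ^ j * \<delta> * real \<mu> ^ (s - j)"
    if "j \<le> s" for j
    using that
  proof (induction j)
    case 0
    show ?case using \<delta> by (intro exI[of _ "[]"]) simp
  next
    case (Suc j)
    then obtain Ks where Ks: "length Ks = j" "\<And>i. i < j \<Longrightarrow> Ks ! i \<subseteq> Fs ! i"
      "real (card (listset (drop j Fs) - foldl (extend adj \<chi>) (listset Fs) Ks)) \<le> 4 ^ j * \<delta> * real \<mu> ^ (s - j)"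
      by auto
    define F where "F = Fs ! j"
    define Fs' where "Fs' = drop (Suc j) Fs"
    define S where "S = foldl (extend adj \<chi>) (listset Fs) Ks"
    define t where "t = s - Suc j"
    have dropF: "drop j Fs = F # Fs'"
      using bl Suc.prems by (simp add: F_def Fs'_def Cons_nth_drop_Suc)
    have sj: "s - j = Suc t" using Suc.prems by (simp add: t_def)
    have FFs: "F \<in> set Fs" using bl Suc.prems by (simp add: F_def)
    have UKs: "\<Union> (set Ks) \<subseteq> \<Union> (set Fs)" "F \<inter> \<Union> (set Ks) = {}"
    proof -
      have "Ki \<subseteq> \<Union> (set Fs) \<and> F \<inter> Ki = {}" if Ki: "Ki \<in> set Ks" for Ki
      proof -
        obtain i where i: "i < j" "Ki = Ks ! i" using Ki Ks(1) by (auto simp: in_set_conv_nth)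
        have "Fs ! i \<inter> F = {}"
          using bl i(1) Suc.prems by (auto simp: blocks_def F_def sorted_wrt_iff_nth_less)
        moreover have "Fs ! i \<in> set Fs" using bl i(1) Suc.prems by simp
        ultimately show ?thesis using Ks(2)[OF i(1)] i(2) by blast
      qed
      then show "\<Union> (set Ks) \<subseteq> \<Union> (set Fs)" "F \<inter> \<Union> (set Ks) = {}" by blast+
    qed
    have "\<exists>K\<subseteq>F. real (card (listset Fs' - extend adj \<chi> S K)) \<le> (4 * \<kappa> * 2 ^ t + 2 * (4 ^ j * \<delta>)) * real \<mu> ^ t"
    proof (rule extend_or_stuck[OF A _ _ \<mu> _ _ _ pos \<theta> m])
      show "blocks A \<mu> (F # Fs')" unfolding dropF[symmetric] by (rule blocks_drop[OF bl(1)])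
      show "length Fs' = t" using bl by (simp add: Fs'_def t_def)
      show "S \<subseteq> listset (F # Fs')"
        unfolding S_def dropF[symmetric] Ks(1)[symmetric] using bl Ks(1) Suc.prems by (intro foldl_extend_subset) auto
      show "real (card (listset (F # Fs') - S)) \<le> 4 ^ j * \<delta> * real \<mu> ^ Suc t"
        using Ks(3) unfolding S_def dropF sj .
      show "0 < 4 ^ j * \<delta>" using \<delta> by simp
      fix K B assume KB: "K \<subseteq> F" "B \<subseteq> F - K" "card B = m"
      have "\<not> stuck adj \<kappa> \<theta> \<mu> Fs Ks K B \<chi>"
      proof (rule not_stuck)
        show "length Ks < s" using Ks(1) Suc.prems by simp
        show "\<Union> (set Ks) \<union> K \<union> B \<subseteq> \<Union> (set Fs)" using UKs KB FFs by blast
        show "B \<inter> (\<Union> (set Ks) \<union> K) = {}" using UKs KB by blast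
      qed (rule KB(3))
      then show "\<exists>v\<in>B. 4 * \<kappa> * 2 ^ t * real \<mu> ^ t \<le> real (card (open_at adj \<chi> S K v)) \<longrightarrow>
        \<theta> * real \<mu> ^ t < real (card (hits {as. sorted_wrt adj as} (open_at adj \<chi> S K v) (\<chi> v)))"
        unfolding stuck_def Let_def S_def[symmetric] bl(2) Ks(1) t_def[symmetric] by (meson not_le)
    qed
    then obtain K where K: "K \<subseteq> F"
      "real (card (listset Fs' - extend adj \<chi> S K)) \<le> (4 * \<kappa> * 2 ^ t + 2 * (4 ^ j * \<delta>)) * real \<mu> ^ t"
      by blast
    have "4 * \<kappa> * 2 ^ t \<le> \<delta>"
      unfolding \<delta>_def using pos by (intro mult_left_mono power_increasing) (auto simp: t_def)
    also have "\<delta> \<le> 4 ^ j * \<delta>" using \<delta> by simp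
    finally have "4 * \<kappa> * 2 ^ t \<le> 4 ^ j * \<delta>" .
    moreover have "4 ^ Suc j * \<delta> = 4 * (4 ^ j * \<delta>)" "0 < 4 ^ j * \<delta>" using \<delta> by simp_all
    ultimately have "4 * \<kappa> * 2 ^ t + 2 * (4 ^ j * \<delta>) \<le> 4 ^ Suc j * \<delta>" by linarith
    then have "(4 * \<kappa> * 2 ^ t + 2 * (4 ^ j * \<delta>)) * real \<mu> ^ t \<le> 4 ^ Suc j * \<delta> * real \<mu> ^ t"
      by (rule mult_right_mono) simp
    with K(2) have "real (card (listset Fs' - extend adj \<chi> S K)) \<le> 4 ^ Suc j * \<delta> * real \<mu> ^ (s - Suc j)"
      unfolding t_def by linarith
    then show ?case
      using Ks(1,2) K(1) by (intro exI[of _ "Ks @ [K]"]) (auto simp: S_def Fs'_def F_def nth_append less_Suc_eq)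
  qed
  from this[of s] obtain Ks where Ks: "length Ks = s"
      "real (card (listset (drop s Fs) - foldl (extend adj \<chi>) (listset Fs) Ks)) \<le> 4 ^ s * \<delta>" by auto
  have "4 ^ s * \<delta> = 4 * \<kappa> * 8 ^ s" by (simp add: \<delta>_def flip: power_mult_distrib)
  then have "card (listset (drop s Fs) - foldl (extend adj \<chi>) (listset Fs) Ks) = 0" using Ks(2) \<kappa> by linarith
  then have "[] \<in> foldl (extend adj \<chi>) (listset Fs) Ks" using bl(2) by (auto simp: card_eq_0_iff)
  from foldl_extend_linked[OF this] Ks(1) show ?thesis by (metis append_Nil2)
qed

section \<open>The hypergraph\<close>

definition forward_edges :: "nat \<Rightarrow> ('c \<Rightarrow> 'c \<Rightarrow> bool) \<Rightarrow> (nat \<Rightarrow> nat \<Rightarrow> 'c) \<Rightarrow> nat set set" where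
  "forward_edges n adj \<chi> = {{u, v, w} | u v w. u < v \<and> v < w \<and> w < n \<and> adj (\<chi> u v) (\<chi> u w)}"

lemma sorted_triple_eq:
  fixes u v w u' v' w' :: nat
  assumes "{u, v, w} = {u', v', w'}" "u < v" "v < w" "u' < v'" "v' < w'"
  shows "u = u' \<and> v = v' \<and> w = w'"
proof -
  have "sorted_list_of_set {u, v, w} = [u, v, w]"
    using assms(2,3) by (simp add: sorted_list_of_set_insert)
  moreover have "sorted_list_of_set {u', v', w'} = [u', v', w']"
    using assms(4,5) by (simp add: sorted_list_of_set_insert)
  ultimately have "[u, v, w] = [u', v', w']" unfolding assms(1) by (rule trans[OF sym])
  then show ?thesis by simp
qed

lemma forward_edges_iff:
  assumes "u < v" "v < w"
  shows "{u, v, w} \<in> forward_edges n adj \<chi> \<longleftrightarrow> w < n \<and> adj (\<chi> u v) (\<chi> u w)"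
proof
  assume "{u, v, w} \<in> forward_edges n adj \<chi>"
  then obtain u' v' w' where *: "{u, v, w} = {u', v', w'}" "u' < v'" "v' < w'"
      "w' < n" "adj (\<chi> u' v') (\<chi> u' w')"
    unfolding forward_edges_def by blast
  with sorted_triple_eq[OF *(1) assms *(2,3)] show "w < n \<and> adj (\<chi> u v) (\<chi> u w)" by simp
next
  assume "w < n \<and> adj (\<chi> u v) (\<chi> u w)"
  with assms show "{u, v, w} \<in> forward_edges n adj \<chi>" unfolding forward_edges_def by blast
qed

lemma kgraph_forward_edges: "kgraph 3 {..<n} (forward_edges n adj \<chi>)"
  by (auto simp: kgraph_def forward_edges_def)

text \<open>
The colours from the smallest vertex to the others are distinct, because \<open>adj\<close> is irreflexive, and pairwise adjacent.
\<close>

lemma forward_edges_clique_free: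
  assumes \<chi>: "\<And>u v. u < n \<Longrightarrow> v < n \<Longrightarrow> \<chi> u v \<in> R" and adj: "symp adj" "irreflp adj"
    and free: "\<And>T. T \<subseteq> R \<Longrightarrow> card T = s \<Longrightarrow> \<exists>x\<in>T. \<exists>y\<in>T. x \<noteq> y \<and> \<not> adj x y" and s: "2 \<le> s"
  shows "\<not> contains_complete 3 (s + 1) {..<n} (forward_edges n adj \<chi>)"
proof
  assume "contains_complete 3 (s + 1) {..<n} (forward_edges n adj \<chi>)"
  then obtain T where T: "T \<subseteq> {..<n}" "card T = s + 1"
      "\<And>e. e \<subseteq> T \<Longrightarrow> card e = 3 \<Longrightarrow> e \<in> forward_edges n adj \<chi>"
    unfolding contains_complete_def by blast
  have finT: "finite T" "T \<noteq> {}" using T(1,2) finite_subset by auto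
  define u where "u = Min T"
  define T' where "T' = T - {u}"
  have u: "u \<in> T" "\<And>v. v \<in> T' \<Longrightarrow> u < v"
    using finT by (auto simp: u_def T'_def order.not_eq_order_implies_strict)
  have pair: "adj (\<chi> u v) (\<chi> u w)" if "v \<in> T'" "w \<in> T'" "v < w" for v w
  proof -
    have "u < v" using u that by blast
    then have "{u, v, w} \<in> forward_edges n adj \<chi>"
      using that u(1) by (intro T(3)) (auto simp: T'_def)
    then show ?thesis using forward_edges_iff[OF \<open>u < v\<close> \<open>v < w\<close>] by blast
  qed
  then have pair': "adj (\<chi> u v) (\<chi> u w)" if "v \<in> T'" "w \<in> T'" "v \<noteq> w" for v w
    using that adj(1) by (metis linorder_neqE_nat sympD)
  then have inj: "inj_on (\<chi> u) T'"
    using adj(2) by (metis inj_onI irreflpD)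
  have "card T' = s" using T(2) finT u(1) by (simp add: T'_def)
  then have "card (\<chi> u ` T') = s" using inj by (simp add: card_image)
  moreover have "\<chi> u ` T' \<subseteq> R" using T(1) u(1) \<chi> by (auto simp: T'_def)
  ultimately obtain x y where "x \<in> \<chi> u ` T'" "y \<in> \<chi> u ` T'" "x \<noteq> y" "\<not> adj x y" using free by blast
  then show False using pair' by auto
qed

lemma forward_clique_complete:
  assumes vs: "sorted_wrt (<) vs" "set vs \<subseteq> W" "W \<subseteq> {..<n}" "length vs = s"
    and adj: "\<And>i. i < s \<Longrightarrow> sorted_wrt adj (map (\<chi> (vs ! i)) (drop (Suc i) vs))"
  shows "contains_complete 3 s W (induced_edges (forward_edges n adj \<chi>) W)"
proof -
  have "e \<in> induced_edges (forward_edges n adj \<chi>) W" if e: "e \<subseteq> set vs" "card e = 3" for e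
  proof -
    have "length (sorted_list_of_set e) = Suc (Suc (Suc 0))" using e by simp
    then obtain a b c where abc: "sorted_list_of_set e = [a, b, c]"
      unfolding length_Suc_conv by auto
    have fin: "finite e" using e(1) finite_subset by blast
    have e_eq: "e = {a, b, c}" using set_sorted_list_of_set[OF fin] abc by simp
    have "sorted_wrt (<) [a, b, c]" using strict_sorted_list_of_set[of e] abc by simp
    then have lt: "a < b" "b < c" by auto
    have in_vs: "a \<in> set vs" "b \<in> set vs" "c \<in> set vs" using e(1) e_eq by auto
    obtain i where i: "i < s" "vs ! i = a" using in_vs(1) vs(4) unfolding in_set_conv_nth by blast
    obtain j where j: "j < s" "vs ! j = b" using in_vs(2) vs(4) unfolding in_set_conv_nth by blast
    obtain k where k: "k < s" "vs ! k = c" using in_vs(3) vs(4) unfolding in_set_conv_nth by blast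
    have mono: "p < q" if "vs ! p < vs ! q" "p < s" "q < s" for p q
    proof (rule ccontr)
      assume "\<not> p < q"
      then have "q < p" using that(1) by (cases "p = q") auto
      then have "vs ! q < vs ! p" using sorted_wrt_nth_less[OF vs(1)] that(2) vs(4) by blast
      then show False using that(1) by simp
    qed
    have "i < j" "j < k" using mono[of i j] mono[of j k] lt i j k by simp_all
    have "sorted_wrt adj (map (\<chi> a) (drop (Suc i) vs))" using adj[OF i(1)] i(2) by simp
    moreover have "j - Suc i < k - Suc i" "k - Suc i < length (map (\<chi> a) (drop (Suc i) vs))"
      using \<open>i < j\<close> \<open>j < k\<close> k(1) vs(4) by auto
    ultimately have "adj (map (\<chi> a) (drop (Suc i) vs) ! (j - Suc i)) (map (\<chi> a) (drop (Suc i) vs) ! (k - Suc i))"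
      by (rule sorted_wrt_nth_less)
    then have "adj (\<chi> a b) (\<chi> a c)" using \<open>i < j\<close> \<open>j < k\<close> i j k vs(4) by simp
    moreover have "c < n" using vs(2,3) e(1) e_eq by auto
    ultimately have "e \<in> forward_edges n adj \<chi>" unfolding e_eq forward_edges_iff[OF lt] by blast
    then show ?thesis using e(1) vs(2) by (auto simp: induced_edges_def)
  qed
  moreover have "card (set vs) = s" using vs(1,4) by (metis distinct_card strict_sorted_iff)
  ultimately show ?thesis unfolding contains_complete_def using vs(2) by blast
qed

lemma increasing_blocks_exist:
  fixes ws :: "nat list"
  shows "sorted_wrt (<) ws \<Longrightarrow> length ws = s * \<mu> \<Longrightarrow>
    \<exists>Fs. length Fs = s \<and> (\<forall>F\<in>set Fs. F \<subseteq> set ws \<and> card F = \<mu>) \<and>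
      sorted_wrt (\<lambda>F G. \<forall>x\<in>F. \<forall>y\<in>G. x < y) Fs"
proof (induction s arbitrary: ws)
  case (Suc s)
  have split: "sorted_wrt (<) (take \<mu> ws @ drop \<mu> ws)" using Suc.prems by simp
  have "length (drop \<mu> ws) = s * \<mu>" using Suc.prems by simp
  with Suc.IH[of "drop \<mu> ws"] split obtain Fs where Fs: "length Fs = s"
      "\<And>F. F \<in> set Fs \<Longrightarrow> F \<subseteq> set (drop \<mu> ws) \<and> card F = \<mu>"
      "sorted_wrt (\<lambda>F G. \<forall>x\<in>F. \<forall>y\<in>G. x < y) Fs"
    unfolding sorted_wrt_append by blast
  have "distinct (take \<mu> ws)" using Suc.prems by (simp add: strict_sorted_iff)
  then have card: "card (set (take \<mu> ws)) = \<mu>" using Suc.prems by (simp add: distinct_card)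
  show ?case
  proof (intro exI[of _ "set (take \<mu> ws) # Fs"] conjI ballI)
    show "sorted_wrt (\<lambda>F G. \<forall>x\<in>F. \<forall>y\<in>G. x < y) (set (take \<mu> ws) # Fs)"
      using Fs split unfolding sorted_wrt_append by fastforce
    fix F assume "F \<in> set (set (take \<mu> ws) # Fs)"
    then show "F \<subseteq> set ws" "card F = \<mu>"
      using Fs card set_take_subset[of \<mu> ws] set_drop_subset[of \<mu> ws] by auto
  qed (use Fs in auto)
qed auto

lemma increasing_listset:
  fixes Fs :: "nat set list"
  shows "sorted_wrt (\<lambda>F G. \<forall>x\<in>F. \<forall>y\<in>G. x < y) Fs \<Longrightarrow> vs \<in> listset Fs \<Longrightarrow> sorted_wrt (<) vs"
proof (induction Fs arbitrary: vs)
  case (Cons F Fs)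
  then obtain v vs' where vs: "vs = v # vs'" "v \<in> F" "vs' \<in> listset Fs" by (auto simp: set_Cons_def)
  then show ?case using Cons set_listset[OF vs(3)] by fastforce
qed auto

text \<open>
The condition on \<open>(card R / \<kappa>) ^ s\<close> keeps the chosen sets below \<open>\<mu> / 4\<close> elements, so that enough of each block
remains for the set of stuck vertices.
\<close>

lemma hypergraph_exists:
  fixes R :: "'c set" and \<kappa> \<rho> \<theta> :: real
  assumes s: "2 \<le> s" and R: "finite R" "R \<noteq> {}" and adj: "symp adj" "irreflp adj"
    and free: "\<And>T. T \<subseteq> R \<Longrightarrow> card T = s \<Longrightarrow> \<exists>x\<in>T. \<exists>y\<in>T. x \<noteq> y \<and> \<not> adj x y"
    and rich: "\<And>t. t < s \<Longrightarrow> rich \<rho> R t {as. sorted_wrt adj as}" and \<rho>: "0 \<le> \<rho>"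
    and \<kappa>: "0 < \<kappa>" "4 * \<kappa> * 8 ^ s < 1" and \<mu>: "real b \<le> \<kappa> * real \<mu>" "0 < \<mu>" "real m \<le> real \<mu> / 4"
    and r: "8 * (real (card R) / \<kappa>) ^ s \<le> real \<mu>"
    and num: "real n ^ (\<mu> * s) * (2 ^ (s * \<mu>)) ^ Suc (Suc s) * real (Suc s)
      * (real s * (real \<mu> * 2 ^ card R) ^ s * (2 ^ \<mu> * (\<rho> / real (card R)) ^ b)) ^ m < 1"
  shows "\<exists>E. kgraph 3 {..<n} E \<and> \<not> contains_complete 3 (s + 1) {..<n} E \<and> \<not> has_free_set 3 s (s * \<mu>) {..<n} E"
proof -
  define \<theta> where "\<theta> = (\<kappa> / real (card R)) ^ s / 2"
  have cR: "0 < card R" using R by (simp add: card_gt_0_iff)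
  have \<theta>: "0 < \<theta>" using \<kappa> cR by (simp add: \<theta>_def)
  have "1 / \<theta> = 2 * (real (card R) / \<kappa>) ^ s" using \<kappa> cR by (simp add: \<theta>_def power_divide)
  then have \<theta>': "1 / \<theta> \<le> real \<mu> / 4" using r by simp
  have "\<kappa> * 1 \<le> \<kappa> * (4 * 8 ^ s)" using \<kappa>(1) one_le_power[of "8::real" s]
    by (intro mult_left_mono) linarith+
  then have \<kappa>1: "\<kappa> \<le> 1" using \<kappa>(2) by linarith
  obtain \<chi> where \<chi>: "\<chi> \<in> PiE {..<n} (\<lambda>_. PiE {..<n} (\<lambda>_. R))"
    "\<And>Fs Ks K B. blocks {..<n} \<mu> Fs \<Longrightarrow> length Fs = s \<Longrightarrow> length Ks < s \<Longrightarrow>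
      \<Union> (set Ks) \<union> K \<union> B \<subseteq> \<Union> (set Fs) \<Longrightarrow> card B = m \<Longrightarrow> B \<inter> (\<Union> (set Ks) \<union> K) = {} \<Longrightarrow>
      \<not> stuck adj \<kappa> \<theta> \<mu> Fs Ks K B \<chi>"
    using no_stuck_colouring[OF finite_lessThan[of n] R \<kappa>(1) \<kappa>1 \<mu>(1,2) \<rho> rich, of s \<theta> m] num
    unfolding \<theta>_def card_lessThan by (metis order_refl)
  define E where "E = forward_edges n adj \<chi>"
  have "\<not> contains_complete 3 (s + 1) {..<n} E"
    unfolding E_def using \<chi>(1) by (intro forward_edges_clique_free[OF _ adj free s]) (auto simp: PiE_iff)
  moreover have "\<not> has_free_set 3 s (s * \<mu>) {..<n} E"
  proof
    assume "has_free_set 3 s (s * \<mu>) {..<n} E"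
    then obtain W where W: "W \<subseteq> {..<n}" "card W = s * \<mu>" "\<not> contains_complete 3 s W (induced_edges E W)"
      unfolding has_free_set_def by blast
    have finW: "finite W" using W(1) finite_subset by blast
    obtain Fs where Fs: "length Fs = s" "\<And>F. F \<in> set Fs \<Longrightarrow> F \<subseteq> W \<and> card F = \<mu>"
      "sorted_wrt (\<lambda>F G. \<forall>x\<in>F. \<forall>y\<in>G. x < y) Fs"
      using increasing_blocks_exist[OF strict_sorted_list_of_set[of W], of s \<mu>] W(2) finW by auto
    have bl: "blocks {..<n} \<mu> Fs"
      unfolding blocks_def using Fs W(1) sorted_wrt_mono_rel[OF _ Fs(3), of "\<lambda>F G. F \<inter> G = {}"] by fastforce
    obtain vs where vs: "vs \<in> listset Fs" "\<And>i. i < s \<Longrightarrow> sorted_wrt adj (map (\<chi> (vs ! i)) (drop (Suc i) vs))"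
      using forward_clique_in_blocks[OF finite_lessThan bl Fs(1) \<mu>(2) \<theta> \<kappa> \<theta>' \<mu>(3) \<chi>(2)[OF bl Fs(1)]] by blast
    have "contains_complete 3 s W (induced_edges E W)"
      unfolding E_def
    proof (rule forward_clique_complete[OF increasing_listset[OF Fs(3) vs(1)] _ W(1) _ vs(2)])
      show "set vs \<subseteq> W" using set_listset[OF vs(1)] Fs(2) by blast
      show "length vs = s" using length_listset[OF vs(1)] Fs(1) by simp
    qed
    then show False using W(3) by simp
  qed
  ultimately show ?thesis using kgraph_forward_edges E_def by blast
qed

section \<open>Choice of the parameters\<close>

lemma power_le_exp: "(2::real) ^ n \<le> exp (real n)"
proof -
  have "(2::real) \<le> exp 1" using exp_ge_add_one_self[of "1::real"] by simp
  then have "(2::real) ^ n \<le> exp 1 ^ n" by (rule power_mono) simp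
  then show ?thesis by (simp flip: exp_of_nat_mult)
qed

text \<open>
The hypothesis of \<open>no_stuck_colouring\<close> with \<open>r / \<rho> = a ^ k\<close>.  In the exponent, a stuck vertex gains
\<open>k * b * ln a\<close>, at least \<open>2 * g * k * \<mu>\<close>, of which half absorbs the lower-order factors, and there are at least \<open>\<mu> / 8\<close> such vertices; this
is twice the cost \<open>c * s * k * \<mu>\<^sup>2\<close> of choosing the blocks, and the rest, of order \<open>\<mu>\<close>, is absorbed for large \<open>k\<close>.
\<close>

lemma union_bound_numeric:
  fixes a c \<kappa> g :: real and s \<mu> k n r b m :: nat
  assumes s: "0 < s" and a: "1 < a" and \<kappa>: "0 < \<kappa>"
    and g: "g = \<kappa> * ln a / 4" and c: "c = g / (16 * real s)"
    and b: "b = nat \<lfloor>\<kappa> * real \<mu>\<rfloor>" and m: "m = \<mu> div 4"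
    and r\<mu>: "r \<le> \<mu>" and \<mu>: "8 \<le> \<mu>" "2 \<le> \<kappa> * real \<mu>"
    and k: "3 * real s + 1 \<le> g * real k" "16 * real s * (real s + 3) < g * real k"
    and n: "real n \<le> exp (c * real k * real \<mu>)"
  shows "real n ^ (\<mu> * s) * (2 ^ (s * \<mu>)) ^ Suc (Suc s) * real (Suc s)
      * (real s * (real \<mu> * 2 ^ r) ^ s * (2 ^ \<mu> * (1 / a ^ k) ^ b)) ^ m < 1"
proof -
  define x where "x = real \<mu>"
  define S where "S = real s"
  have x: "8 \<le> x" using \<mu>(1) by (simp add: x_def)
  have S: "1 \<le> S" using s by (simp add: S_def)
  have g0: "0 < g" using a \<kappa> by (simp add: g)
  have real_le_exp: "real j \<le> exp (real j)" "real (Suc j) \<le> exp (real j)" for j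
    using exp_ge_add_one_self[of "real j"] unfolding of_nat_Suc by linarith+
  have m_ge: "x / 8 \<le> real m"
  proof -
    have "\<mu> \<le> 8 * m" using \<mu>(1) by (simp add: m)
    then have "real \<mu> \<le> real (8 * m)" by (rule of_nat_mono)
    then show ?thesis by (simp add: x_def)
  qed
  have b_ge: "\<kappa> * x / 2 \<le> real b"
    using \<mu>(2) unfolding b x_def by linarith
  define \<beta> where "\<beta> = S * (x * 2 ^ r) ^ s * (2 ^ \<mu> * (1 / a ^ k) ^ b)"
  have \<beta>: "\<beta> \<le> exp (- (g * real k * x))"
  proof -
    have "x * 2 ^ r \<le> exp x * exp x"
    proof (rule mult_mono)
      have "(2::real) ^ r \<le> exp (real r)" by (rule power_le_exp)
      also have "\<dots> \<le> exp x" using r\<mu> by (simp add: x_def)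
      finally show "(2::real) ^ r \<le> exp x" .
    qed (use real_le_exp(1)[of \<mu>] in \<open>simp_all add: x_def\<close>)
    also have "\<dots> = exp (2 * x)" by (simp flip: exp_add)
    finally have "(x * 2 ^ r) ^ s \<le> exp (2 * x) ^ s" using x by (intro power_mono) auto
    also have "\<dots> = exp (2 * S * x)" by (simp add: S_def mult_ac flip: exp_of_nat_mult)
    finally have 1: "(x * 2 ^ r) ^ s \<le> exp (2 * S * x)" .
    have 2: "(2::real) ^ \<mu> \<le> exp x" unfolding x_def by (rule power_le_exp)
    have "(1 / a ^ k) ^ b = exp (- (real k * real b * ln a))"
    proof -
      have "a ^ (k * b) = exp (real (k * b) * ln a)"
        using a by (simp only: exp_of_nat_mult exp_ln)
      then show ?thesis by (simp add: power_one_over exp_minus inverse_eq_divide flip: power_mult)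
    qed
    also have "\<dots> \<le> exp (- (2 * g * real k * x))"
    proof -
      have "(\<kappa> * x / 2) * (real k * ln a) \<le> real b * (real k * ln a)"
        using b_ge a by (intro mult_right_mono) auto
      then show ?thesis by (simp add: g mult_ac)
    qed
    finally have 3: "(1 / a ^ k) ^ b \<le> exp (- (2 * g * real k * x))" .
    have 4: "S \<le> exp (S * x)"
    proof -
      have "S \<le> exp S" unfolding S_def by (rule real_le_exp)
      also have "S * 1 \<le> S * x" using x S by (intro mult_left_mono) auto
      then have "exp S \<le> exp (S * x)" by simp
      finally show ?thesis .
    qed
    have "\<beta> \<le> exp (S * x) * exp (2 * S * x) * (exp x * exp (- (2 * g * real k * x)))"
      unfolding \<beta>_def using 1 2 3 4 x S a by (intro mult_mono) auto
    also have "\<dots> = exp ((3 * S + 1) * x - 2 * g * real k * x)"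
      by (simp add: algebra_simps flip: exp_add)
    also have "\<dots> \<le> exp (- (g * real k * x))"
    proof -
      have "(3 * S + 1) * x \<le> (g * real k) * x" using k(1) x by (intro mult_right_mono) (auto simp: S_def)
      then show ?thesis by (simp add: algebra_simps)
    qed
    finally show ?thesis .
  qed
  have \<beta>0: "0 \<le> \<beta>" unfolding \<beta>_def using x S a by auto
  have "\<beta> ^ m \<le> exp (- (g * real k * x)) ^ m" using \<beta> \<beta>0 by (rule power_mono)
  also have "\<dots> = exp (- (g * real k * x * real m))" by (simp add: mult_ac flip: exp_of_nat_mult)
  also have "\<dots> \<le> exp (- (g * real k * x * (x / 8)))"
    using m_ge g0 x by (auto intro!: mult_left_mono)
  finally have E1: "\<beta> ^ m \<le> exp (- (g * real k * x * (x / 8)))" .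
  have "real n ^ (\<mu> * s) \<le> exp (c * real k * x) ^ (\<mu> * s)"
    using n unfolding x_def by (rule power_mono) simp
  also have "\<dots> = exp (c * S * real k * x * x)"
    by (simp add: x_def S_def mult_ac flip: exp_of_nat_mult)
  also have "c * S * real k * x * x = g * real k * x * (x / 16)" using S by (simp add: c S_def)
  finally have E2: "real n ^ (\<mu> * s) \<le> exp (g * real k * x * (x / 16))" .
  have "((2::real) ^ (s * \<mu>)) ^ Suc (Suc s) = 2 ^ (s * \<mu> * Suc (Suc s))" by (simp only: power_mult)
  also have "\<dots> \<le> exp (real (s * \<mu> * Suc (Suc s)))" by (rule power_le_exp)
  also have "real (s * \<mu> * Suc (Suc s)) = S * x * (S + 2)" by (simp add: S_def x_def algebra_simps)
  finally have E3: "((2::real) ^ (s * \<mu>)) ^ Suc (Suc s) \<le> exp (S * x * (S + 2))" .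
  have E4: "real (Suc s) \<le> exp (S * x)"
  proof -
    have "real (Suc s) \<le> exp S" unfolding S_def by (rule real_le_exp)
    also have "S * 1 \<le> S * x" using x S by (intro mult_left_mono) auto
    then have "exp S \<le> exp (S * x)" by simp
    finally show ?thesis .
  qed
  have "real n ^ (\<mu> * s) * (2 ^ (s * \<mu>)) ^ Suc (Suc s) * real (Suc s) * \<beta> ^ m
      \<le> exp (g * real k * x * (x / 16)) * exp (S * x * (S + 2)) * exp (S * x) * exp (- (g * real k * x * (x / 8)))"
    using E1 E2 E3 E4 \<beta>0 by (intro mult_mono) auto
  also have "\<dots> = exp (x * (S * (S + 3) - g * real k * (x / 16)))"
    by (simp add: algebra_simps flip: exp_add)
  also have "\<dots> < 1"
  proof -
    have "g * real k * 1 \<le> g * real k * x" using g0 x by (intro mult_left_mono) auto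
    then have "16 * S * (S + 3) < g * real k * x" using k(2) unfolding S_def by linarith
    then have "x * (S * (S + 3) - g * real k * (x / 16)) < 0"
      using x by (intro mult_pos_neg) auto
    then show ?thesis by simp
  qed
  finally show ?thesis by (simp only: \<beta>_def S_def x_def)
qed

text \<open>
The hypergraphs in terms of the parameter \<open>k\<close> of the colour graph: \<open>\<mu>\<close> must be at least a power of the number of
colours, and \<open>ln n\<close> may then be as large as a constant times \<open>k * \<mu>\<close>.
\<close>

lemma sparse_hypergraphs:
  assumes s: "3 \<le> s"
  shows "\<exists>(c::real) M::nat. 0 < c \<and> 2 \<le> M \<and> (\<forall>\<^sub>F k in sequentially. \<forall>\<mu> n. M ^ k \<le> \<mu> \<longrightarrow>
    real n \<le> exp (c * real k * real \<mu>) \<longrightarrow>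
    (\<exists>E. kgraph 3 {..<n} E \<and> \<not> contains_complete 3 (s + 1) {..<n} E \<and> \<not> has_free_set 3 s (s * \<mu>) {..<n} E))"
proof -
  obtain Q :: nat and a :: real where Q: "2 \<le> Q" "1 < a" and
    G: "\<forall>\<^sub>F k in sequentially. \<exists>(R :: nat list set) adj. card R = Q ^ k \<and> symp adj \<and> irreflp adj \<and>
      (\<forall>T\<subseteq>R. card T = s \<longrightarrow> (\<exists>x\<in>T. \<exists>y\<in>T. x \<noteq> y \<and> \<not> adj x y)) \<and>
      (\<forall>t<s. rich (real Q ^ k / a ^ k) R t {as. sorted_wrt adj as})"
    using colour_graph_exists[OF s] by blast
  define \<kappa> :: real where "\<kappa> = 1 / 8 ^ Suc s"
  define g where "g = \<kappa> * ln a / 4"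
  define c where "c = g / (16 * real s)"
  define K0 where "K0 = 8 / \<kappa> ^ s + (3 * real s + 1) / g + (16 * real s * (real s + 3)) / g + 2 / \<kappa> + 8"
  have \<kappa>: "0 < \<kappa>" "4 * \<kappa> * 8 ^ s < 1" by (simp_all add: \<kappa>_def)
  have g: "0 < g" using \<kappa> Q by (simp add: g_def)
  have c: "0 < c" using g s by (simp add: c_def)
  have "\<forall>\<^sub>F k in sequentially. nat \<lceil>K0\<rceil> < k" by (rule eventually_gt_at_top)
  with G have "\<forall>\<^sub>F k in sequentially. \<forall>\<mu> n. (Q ^ Suc s) ^ k \<le> \<mu> \<longrightarrow>
    real n \<le> exp (c * real k * real \<mu>) \<longrightarrow>
    (\<exists>E. kgraph 3 {..<n} E \<and> \<not> contains_complete 3 (s + 1) {..<n} E \<and> \<not> has_free_set 3 s (s * \<mu>) {..<n} E)"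
  proof eventually_elim
    case (elim k)
    then obtain R :: "nat list set" and adj where R: "card R = Q ^ k" "symp adj" "irreflp adj"
      "\<And>T. T \<subseteq> R \<Longrightarrow> card T = s \<Longrightarrow> \<exists>x\<in>T. \<exists>y\<in>T. x \<noteq> y \<and> \<not> adj x y"
      "\<And>t. t < s \<Longrightarrow> rich (real Q ^ k / a ^ k) R t {as. sorted_wrt adj as}" by blast
    have kK: "K0 < real k" using elim(2) by linarith
    have terms: "0 \<le> 8 / \<kappa> ^ s" "0 \<le> (3 * real s + 1) / g" "0 \<le> (16 * real s * (real s + 3)) / g" "0 \<le> 2 / \<kappa>"
      using \<kappa> g by auto
    have k: "8 / \<kappa> ^ s < real k" "(3 * real s + 1) / g < real k" "(16 * real s * (real s + 3)) / g < real k"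
      "2 / \<kappa> < real k" "8 < real k"
      using kK terms unfolding K0_def by linarith+
    have kQ: "real k \<le> real (Q ^ k)"
    proof -
      have "k \<le> 2 ^ k" by (simp add: less_imp_le)
      also have "\<dots> \<le> Q ^ k" using Q(1) by (rule power_mono) simp
      finally show ?thesis by (rule of_nat_mono)
    qed
    have Q0: "0 < Q ^ k" using Q by simp
    show ?case
    proof (intro allI impI)
      fix \<mu> n assume \<mu>: "(Q ^ Suc s) ^ k \<le> \<mu>" and n: "real n \<le> exp (c * real k * real \<mu>)"
      have Qk: "(Q ^ Suc s) ^ k = (Q ^ k) ^ s * Q ^ k" by (simp add: power_mult_distrib mult.commute flip: power_mult)
      have r\<mu>: "Q ^ k \<le> \<mu>"
      proof -
        have "1 * Q ^ k \<le> (Q ^ k) ^ s * Q ^ k" using Q0 by (intro mult_right_mono) auto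
        also have "\<dots> \<le> \<mu>" using \<mu> unfolding Qk .
        finally show ?thesis by simp
      qed
      then have k\<mu>: "real k \<le> real \<mu>" using kQ by (meson of_nat_mono order_trans)
      show "\<exists>E. kgraph 3 {..<n} E \<and> \<not> contains_complete 3 (s + 1) {..<n} E \<and> \<not> has_free_set 3 s (s * \<mu>) {..<n} E"
      proof (rule hypergraph_exists[OF _ _ _ R(2,3,4,5) _ \<kappa>, where b = "nat \<lfloor>\<kappa> * real \<mu>\<rfloor>" and m = "\<mu> div 4"])
        show "2 \<le> s" using s by simp
        show "finite R" "R \<noteq> {}" using R(1) Q0 by (metis card.infinite less_irrefl, metis card.empty less_irrefl)
        show "0 \<le> real Q ^ k / a ^ k" using Q by simp
        show "real (nat \<lfloor>\<kappa> * real \<mu>\<rfloor>) \<le> \<kappa> * real \<mu>" using \<kappa>(1) by simp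
        show "0 < \<mu>" using r\<mu> Q0 by linarith
        have "real (4 * (\<mu> div 4)) \<le> real \<mu>" by (rule of_nat_mono) simp
        then show "real (\<mu> div 4) \<le> real \<mu> / 4" by simp
        have "8 * (real (card R) / \<kappa>) ^ s = (8 / \<kappa> ^ s) * real (Q ^ k) ^ s"
          by (simp add: R(1) power_divide)
        also have "\<dots> \<le> real (Q ^ k) * real (Q ^ k) ^ s" using less_imp_le[OF less_le_trans[OF k(1) kQ]] by (rule mult_right_mono) simp
        also have "\<dots> = real ((Q ^ k) ^ s * Q ^ k)" by simp
        also have "\<dots> \<le> real \<mu>" using \<mu> Qk by (metis of_nat_mono)
        finally show "8 * (real (card R) / \<kappa>) ^ s \<le> real \<mu>" .
        have ratio: "real Q ^ k / a ^ k / real (card R) = 1 / a ^ k" using R(1) Q by simp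
        show "real n ^ (\<mu> * s) * (2 ^ (s * \<mu>)) ^ Suc (Suc s) * real (Suc s) *
          (real s * (real \<mu> * 2 ^ card R) ^ s * (2 ^ \<mu> * (real Q ^ k / a ^ k / real (card R)) ^ nat \<lfloor>\<kappa> * real \<mu>\<rfloor>)) ^ (\<mu> div 4) < 1"
          unfolding ratio
        proof (rule union_bound_numeric[OF _ Q(2) \<kappa>(1) g_def c_def refl refl _ _ _ _ _ n])
          show "0 < s" using s by simp
          show "card R \<le> \<mu>" using R(1) r\<mu> by simp
          have "8 < real \<mu>" using k(5) k\<mu> by linarith
          then show "8 \<le> \<mu>" by linarith
          have "2 / \<kappa> \<le> real \<mu>" using k(4) k\<mu> by linarith
          then show "2 \<le> \<kappa> * real \<mu>" using \<kappa>(1) by (simp add: pos_divide_le_eq mult.commute)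
          show "3 * real s + 1 \<le> g * real k" using k(2) g by (simp add: pos_divide_less_eq mult.commute)
          show "16 * real s * (real s + 3) < g * real k" using k(3) g by (simp add: pos_divide_less_eq mult.commute)
        qed
      qed
    qed
  qed
  moreover have "2 \<le> Q ^ Suc s"
  proof -
    have "Q = Q ^ 1" by simp
    also have "\<dots> \<le> Q ^ Suc s" using Q(1) by (intro power_increasing) auto
    finally show ?thesis using Q(1) by linarith
  qed
  ultimately show ?thesis using c by blast
qed

theorem theorem1p3:
  fixes s :: nat
  assumes "s \<ge> 3"
  shows "\<exists>C::real. C > 0 \<and>
    (\<forall>\<^sub>F n in sequentially. real (erdos_rogers 3 s (s + 1) n) \<le> C * (ln (real n) / ln (ln (real n))))"
proof -
  obtain c :: real and M :: nat where c: "0 < c" and M: "2 \<le> M" and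
    ev: "\<forall>\<^sub>F k in sequentially. \<forall>\<mu> n. M ^ k \<le> \<mu> \<longrightarrow> real n \<le> exp (c * real k * real \<mu>) \<longrightarrow>
      (\<exists>E. kgraph 3 {..<n} E \<and> \<not> contains_complete 3 (s + 1) {..<n} E \<and> \<not> has_free_set 3 s (s * \<mu>) {..<n} E)"
    using sparse_hypergraphs[OF assms] by blast
  define l where "l = ln (real M)"
  have l: "0 < l" using M by (simp add: l_def)
  define C where "C = real s * (4 * l / c + 1)"
  \<comment> \<open>This makes \<open>M ^ k n\<close> at most \<open>sqrt (ln n)\<close>, while \<open>k n\<close> is still of order \<open>ln (ln n)\<close>.\<close>
  define k where "k n = nat \<lfloor>ln (ln (real n)) / (2 * l)\<rfloor>" for n :: nat
  have lim1: "filterlim (\<lambda>n. ln (real n)) at_top sequentially"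
    by (rule filterlim_compose[OF ln_at_top filterlim_real_sequentially])
  have lim2: "filterlim (\<lambda>n. ln (ln (real n))) at_top sequentially"
    by (rule filterlim_compose[OF ln_at_top lim1])
  have limk: "filterlim k at_top sequentially"
    unfolding filterlim_at_top
  proof
    fix Z :: nat
    have "\<forall>\<^sub>F n in sequentially. real Z * (2 * l) \<le> ln (ln (real n))"
      using lim2 unfolding filterlim_at_top by blast
    then show "\<forall>\<^sub>F n in sequentially. Z \<le> k n"
    proof eventually_elim
      case (elim n)
      then have "real Z \<le> ln (ln (real n)) / (2 * l)" using l by (simp add: pos_le_divide_eq)
      then show ?case unfolding k_def by linarith
    qed
  qed
  have small: "\<forall>\<^sub>F y in at_top. ln y / y < l / c"
    using ln_x_over_x_tendsto_0 l c by (intro order_tendstoD(2)[of _ 0]) auto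
  have "\<forall>\<^sub>F n in sequentially. ln (sqrt (ln (real n))) / sqrt (ln (real n)) < l / c"
    by (rule eventually_compose_filterlim[OF small filterlim_compose[OF sqrt_at_top lim1]])
  moreover have "\<forall>\<^sub>F n in sequentially. 4 * l \<le> ln (ln (real n))"
    using lim2 unfolding filterlim_at_top by blast
  moreover have "\<forall>\<^sub>F n in sequentially. 1 < ln (real n)"
    using lim1 unfolding filterlim_at_top_dense by blast
  moreover have "\<forall>\<^sub>F n in sequentially. \<forall>\<mu> n'. M ^ k n \<le> \<mu> \<longrightarrow> real n' \<le> exp (c * real (k n) * real \<mu>) \<longrightarrow>
      (\<exists>E. kgraph 3 {..<n'} E \<and> \<not> contains_complete 3 (s + 1) {..<n'} E \<and> \<not> has_free_set 3 s (s * \<mu>) {..<n'} E)"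
    by (rule eventually_compose_filterlim[OF ev limk])
  ultimately have "\<forall>\<^sub>F n in sequentially. real (erdos_rogers 3 s (s + 1) n) \<le> C * (ln (real n) / ln (ln (real n)))"
  proof eventually_elim
    case (elim n)
    define L where "L = ln (real n)"
    define q where "q = real (k n)"
    have L: "1 < L" "4 * l \<le> ln L" "ln (sqrt L) / sqrt L < l / c" using elim by (simp_all add: L_def)
    have lnL: "0 < ln L" using L(1) by simp
    have n0: "0 < real n"
      using L(1) unfolding L_def by (cases "n = 0") auto
    have "2 \<le> ln L / (2 * l)" using L(2) l by (simp add: pos_le_divide_eq)
    then have q: "ln L / (4 * l) \<le> q" "q \<le> ln L / (2 * l)" "1 \<le> q"
    proof -
      have *: "ln L / (2 * l) - 1 \<le> q" "q \<le> ln L / (2 * l)"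
        using \<open>2 \<le> ln L / (2 * l)\<close> unfolding q_def k_def L_def by linarith+
      have "ln L / (4 * l) = (ln L / (2 * l)) / 2" by simp
      then show "ln L / (4 * l) \<le> q" "q \<le> ln L / (2 * l)" "1 \<le> q"
        using * \<open>2 \<le> ln L / (2 * l)\<close> by linarith+
    qed
    define \<mu> where "\<mu> = nat \<lceil>L / (c * q)\<rceil>"
    have cq: "0 < c * q" using c q by simp
    have \<mu>: "L / (c * q) \<le> real \<mu>" "real \<mu> \<le> L / (c * q) + 1"
    proof -
      have "0 < L / (c * q)" using L(1) cq by simp
      then show "L / (c * q) \<le> real \<mu>" "real \<mu> \<le> L / (c * q) + 1" unfolding \<mu>_def by linarith+
    qed
    have "M ^ k n \<le> \<mu>"
    proof -
      have "real M ^ k n = exp (q * l)"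
        using M by (simp add: q_def l_def exp_of_nat_mult)
      also have "\<dots> \<le> exp (ln L / 2)"
        using q(2) l by (simp add: pos_le_divide_eq mult_ac)
      also have "\<dots> = sqrt L" using L(1) by (simp add: ln_sqrt[symmetric])
      also have "\<dots> \<le> L / (c * q)"
      proof -
        have "c * q \<le> c * (ln L / (2 * l))" using q(2) c by (intro mult_left_mono) auto
        also have "\<dots> = (c / l) * ln (sqrt L)" using L(1) by (simp add: ln_sqrt)
        also have "\<dots> \<le> sqrt L"
          using L(1,3) l c by (simp add: divide_less_eq less_divide_eq field_simps)
        finally have "sqrt L * (c * q) \<le> sqrt L * sqrt L" using L(1) by (intro mult_left_mono) auto
        then show ?thesis using L(1) cq by (simp add: pos_le_divide_eq)
      qed
      also have "\<dots> \<le> real \<mu>" by (rule \<mu>(1))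
      finally show ?thesis by (simp flip: of_nat_power)
    qed
    moreover have "real n \<le> exp (c * real (k n) * real \<mu>)"
    proof -
      have "L \<le> real \<mu> * (c * q)" using \<mu>(1) cq by (simp add: pos_divide_le_eq)
      then have "exp L \<le> exp (c * q * real \<mu>)" by (simp add: mult_ac)
      then show ?thesis using n0 by (simp add: L_def q_def)
    qed
    ultimately obtain E where E: "kgraph 3 {..<n} E" "\<not> contains_complete 3 (s + 1) {..<n} E"
      "\<not> has_free_set 3 s (s * \<mu>) {..<n} E" using elim(4) by blast
    have "\<not> s * \<mu> \<le> erdos_rogers 3 s (s + 1) n"
    proof
      assume "s * \<mu> \<le> erdos_rogers 3 s (s + 1) n"
      then have "\<forall>(V::nat set) E. kgraph 3 V E \<and> card V = n \<and> \<not> contains_complete 3 (s + 1) V E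
          \<longrightarrow> has_free_set 3 s (s * \<mu>) V E"
        using assms by (subst (asm) le_erdos_rogers_iff) auto
      then show False using E by (metis card_lessThan)
    qed
    then have "real (erdos_rogers 3 s (s + 1) n) \<le> real (s * \<mu>)" by (intro of_nat_mono) simp
    also have "\<dots> \<le> real s * (L / (c * q) + 1)" using \<mu>(2) by (simp add: mult_left_mono)
    also have "\<dots> \<le> real s * ((4 * l / c) * (L / ln L) + L / ln L)"
    proof (intro mult_left_mono add_mono)
      have "L / (c * q) \<le> L / (c * (ln L / (4 * l)))"
        using q(1,3) c L(1) lnL l by (intro divide_left_mono mult_left_mono mult_pos_pos) auto
      then show "L / (c * q) \<le> (4 * l / c) * (L / ln L)" by (simp add: mult_ac)
      have "ln L \<le> L" using ln_le_minus_one[of L] L(1) by simp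
      then show "1 \<le> L / ln L" using lnL by simp
    qed simp
    also have "\<dots> = C * (L / ln L)" by (simp add: C_def algebra_simps)
    finally show ?case by (simp only: L_def)
  qed
  moreover have "0 < C" using assms l c by (simp add: C_def add_pos_pos)
  ultimately show ?thesis by blast
qed

end
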